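(* Let $H\in\mathcal{H}$ with $H\notin\{K_{1,3},K^+_{1,3}\}$. Then (1) $K_{1,4}\le H$, $P_5\le H$ or $C_3\le H$; (2) if $H\le P_5$, then $H=P_5$; (3) if $H\le C_3$, then $H=C_3$; (4) if $H\le K_{1,4}$, then $H=K_{1,4}$ or $H=K^+_{1,4}$.
   Context: All graphs are finite and simple, considered up to isomorphism (equalities between graphs mean isomorphism). An edge-colored graph is a pair $(G,c)$ with $c\colon E(G)\to\mathbb{N}$ an arbitrary map (not necessarily proper); it is colored in $t$ or more colors if $|c(E(G))|\ge t$. A subgraph (not necessarily induced) is rainbow if its edges receive pairwise distinct colors. $(G,c)$ is rainbow $H$-free if $G$ contains no rainbow subgraph isomorphic to $H$. For graphs $H_1,H_2$, write $H_1\le H_2$ if there is a positive integer $t$ such that every rainbow $H_1$-free edge-colored complete graph colored in $t$ or more colors is rainbow $H_2$-free. $\mathcal{H}$ denotes the set of connected finite simple graphs other than the paths $P_1,P_2,P_3,P_4$. $P_k$ and $C_k$ are the path and cycle on $k$ vertices. $K_{1,k}$ is the star with $k$ leaves, and $K^+_{1,k}$ is obtained from $K_{1,k}$ by subdividing one edge with one new vertex. *)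

theory Defs
  imports "HOL-Library.Ramsey"
begin

record 'a sgraph =
  vertices :: "'a set"
  edges :: "'a set set"

definition simple_graph :: "'a sgraph \<Rightarrow> bool" where
  "simple_graph G \<longleftrightarrow> finite (vertices G) \<and> edges G \<subseteq> nsets (vertices G) 2"

definition complete_graph :: "'a sgraph \<Rightarrow> bool" where
  "complete_graph G \<longleftrightarrow> finite (vertices G) \<and> edges G = nsets (vertices G) 2"

definition connected_graph :: "'a sgraph \<Rightarrow> bool" where
  "connected_graph G \<longleftrightarrow> vertices G \<noteq> {} \<and>
     (\<forall>u\<in>vertices G. \<forall>v\<in>vertices G. (u, v) \<in> {(x, y). {x, y} \<in> edges G}\<^sup>*)"

definition graph_iso :: "'a sgraph \<Rightarrow> 'b sgraph \<Rightarrow> bool" where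
  "graph_iso G H \<longleftrightarrow> (\<exists>f. bij_betw f (vertices G) (vertices H) \<and>
     (\<forall>u\<in>vertices G. \<forall>v\<in>vertices G. {u, v} \<in> edges G \<longleftrightarrow> {f u, f v} \<in> edges H))"

definition subgraph :: "'a sgraph \<Rightarrow> 'a sgraph \<Rightarrow> bool" where
  "subgraph F G \<longleftrightarrow> simple_graph F \<and> vertices F \<subseteq> vertices G \<and> edges F \<subseteq> edges G"

definition path_graph :: "nat \<Rightarrow> nat sgraph" where
  "path_graph k = \<lparr>vertices = {..<k}, edges = {{i, Suc i} | i. Suc i < k}\<rparr>"

text \<open>This is the cycle on \<open>k\<close> vertices only for \<open>k \<ge> 3\<close>.\<close>

definition cycle_graph :: "nat \<Rightarrow> nat sgraph" where
  "cycle_graph k = \<lparr>vertices = {..<k}, edges = {{i, Suc i mod k} | i. i < k}\<rparr>"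

definition star_graph :: "nat \<Rightarrow> nat sgraph" where
  "star_graph k = \<lparr>vertices = {..k}, edges = {{0, i} | i. 1 \<le> i \<and> i \<le> k}\<rparr>"

text \<open>Subdivision of the edge \<open>{u, v}\<close>, where \<open>w\<close> is meant to be a new vertex.\<close>

definition subdivide_edge :: "'a sgraph \<Rightarrow> 'a \<Rightarrow> 'a \<Rightarrow> 'a \<Rightarrow> 'a sgraph" where
  "subdivide_edge G u v w =
     \<lparr>vertices = insert w (vertices G), edges = (edges G - {{u, v}}) \<union> {{u, w}, {w, v}}\<rparr>"

text \<open>\<open>K\<^sup>+\<^sub>1\<^sub>,\<^sub>k\<close> for \<open>k \<ge> 1\<close>; all edges of a star are equivalent under automorphisms,
  so the choice of the subdivided edge \<open>{0, k}\<close> is immaterial.\<close>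

definition star_plus_graph :: "nat \<Rightarrow> nat sgraph" where
  "star_plus_graph k = subdivide_edge (star_graph k) 0 k (Suc k)"

text \<open>A coloring of \<open>G\<close> is given by a total function of which only the values on \<open>edges G\<close>
  are used.\<close>

definition rainbow :: "('a set \<Rightarrow> nat) \<Rightarrow> 'a sgraph \<Rightarrow> bool" where
  "rainbow c F \<longleftrightarrow> inj_on c (edges F)"

definition rainbow_free :: "'b sgraph \<Rightarrow> 'a sgraph \<Rightarrow> ('a set \<Rightarrow> nat) \<Rightarrow> bool" where
  "rainbow_free H G c \<longleftrightarrow> \<not> (\<exists>F. subgraph F G \<and> rainbow c F \<and> graph_iso F H)"

text \<open>Complete graphs are taken with vertices in \<^typ>\<open>nat\<close>; every finite graph is isomorphic
  to one of this kind.\<close>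

definition rainbow_le :: "'a sgraph \<Rightarrow> 'b sgraph \<Rightarrow> bool" where
  "rainbow_le H\<^sub>1 H\<^sub>2 \<longleftrightarrow> (\<exists>t>0. \<forall>(G :: nat sgraph) c.
     complete_graph G \<longrightarrow> card (c ` edges G) \<ge> t \<longrightarrow> rainbow_free H\<^sub>1 G c \<longrightarrow> rainbow_free H\<^sub>2 G c)"

text \<open>Membership in the class of connected graphs other than the paths on at most four vertices.\<close>

definition in_calH :: "'a sgraph \<Rightarrow> bool" where
  "in_calH H \<longleftrightarrow> simple_graph H \<and> connected_graph H \<and> (\<forall>k\<in>{1, 2, 3, 4}. \<not> graph_iso H (path_graph k))"

end

theory Submission
  imports Defs
begin

text \<open>A connected graph other than \<open>P\<^sub>1, \<dots>, P\<^sub>4\<close>, \<open>K\<^sub>1\<^sub>,\<^sub>3\<close>, \<open>K\<^sup>+\<^sub>1\<^sub>,\<^sub>3\<close> contains \<open>K\<^sub>1\<^sub>,\<^sub>4\<close>,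
  \<open>P\<^sub>5\<close>, \<open>C\<^sub>3\<close>, \<open>C\<^sub>4\<close> or the double star (two adjacent vertices of degree 3). A rainbow
  \<open>C\<^sub>4\<close> forces a rainbow \<open>C\<^sub>3\<close>, and a rainbow double star forces a rainbow \<open>P\<^sub>5\<close>; this gives (1).
  For (2)--(4), a graph below \<open>F\<close> has a rainbow copy in every coloring of the complete graph on the
  natural numbers that uses infinitely many colors and contains a rainbow \<open>F\<close>. Four colorings
  suffice: by the smaller endpoint (no rainbow cycles); a rainbow star with all other edges of one
  color; a rainbow matching plus one edge joined to it, with all other edges of one color; and
  disjoint blocks of four vertices, with edges inside a block colored by the larger endpoint and all
  other edges by one color (rainbow degree at most 4).\<close>

section \<open>Edges, connectedness and a criterion for isomorphism\<close>

lemma edgeD: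
  assumes "simple_graph G" "{u, v} \<in> edges G"
  shows "u \<in> vertices G" "v \<in> vertices G" "u \<noteq> v"
  using assms by (auto simp: simple_graph_def nsets_def card_insert_if split: if_splits)

lemma edgeE:
  assumes "simple_graph G" "e \<in> edges G"
  obtains u v where "e = {u, v}" "u \<noteq> v"
  using assms unfolding simple_graph_def by (meson nsets2_E subset_eq)

lemma edge_subset:
  assumes "simple_graph G" "e \<in> edges G"
  shows "e \<subseteq> vertices G"
  using assms by (auto simp: simple_graph_def nsets_def)

lemma Union_subset_vertices:
  assumes "simple_graph G" "E \<subseteq> edges G"
  shows "\<Union>E \<subseteq> vertices G"
  using assms edge_subset by blast

lemma connected_closed:
  assumes con: "connected_graph G" and x: "x \<in> vertices G" "x \<in> S"
    and closed: "\<And>u v. u \<in> S \<Longrightarrow> {u, v} \<in> edges G \<Longrightarrow> v \<in> S"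
  shows "vertices G \<subseteq> S"
proof
  fix y assume "y \<in> vertices G"
  with con x have "(x, y) \<in> {(x, y). {x, y} \<in> edges G}\<^sup>*"
    by (auto simp: connected_graph_def)
  then show "y \<in> S"
    by (induction rule: rtrancl_induct) (use x closed in auto)
qed

text \<open>Used for every identification of a connected graph with a concrete one: \<open>S\<close>
  and \<open>E\<close> are the expected vertices and edges. If all edges at \<open>S\<close> are
  expected ones, \<open>S\<close> is closed under adjacency, so connectedness leaves no other vertex
  and hence no other edge.\<close>

lemma connected_eq:
  assumes G: "simple_graph G" "connected_graph G" and x: "x \<in> vertices G" "x \<in> S"
    and E: "E \<subseteq> edges G" "\<Union>E \<subseteq> S" "S \<subseteq> vertices G"
    and closed: "\<And>u v. u \<in> S \<Longrightarrow> {u, v} \<in> edges G \<Longrightarrow> {u, v} \<in> E"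
  shows "vertices G = S \<and> edges G = E"
proof
  have sub: "vertices G \<subseteq> S"
    by (rule connected_closed[OF G(2) x]) (use closed E in blast)
  then show "vertices G = S" using E by auto
  show "edges G = E"
  proof
    show "edges G \<subseteq> E"
    proof
      fix e assume e: "e \<in> edges G"
      then obtain u v where uv: "e = {u, v}" using edgeE[OF G(1)] by blast
      then have "u \<in> S" using edgeD(1)[OF G(1)] e sub by blast
      then show "e \<in> E" using closed e uv by blast
    qed
  qed (rule E)
qed

text \<open>The isomorphism is given from the standard graph to \<open>G\<close>, by the list of images of
  \<open>0, 1, 2, \<dots>\<close>.\<close>

lemma graph_iso_nth:
  assumes F: "simple_graph F" "vertices F = {..<length xs}"
    and "distinct xs" "vertices G = set xs" "edges G = image (nth xs) ` edges F"
  shows "graph_iso G F"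
proof -
  define g where "g = nth xs"
  define f where "f = inv_into {..<length xs} g"
  have bij: "bij_betw g {..<length xs} (set xs)"
    using assms(3) unfolding g_def by (rule bij_betw_nth) auto
  have bij': "bij_betw f (set xs) {..<length xs}"
    unfolding f_def by (rule bij_betw_inv_into[OF bij])
  have gf: "g (f u) = u" if "u \<in> set xs" for u
    using bij that unfolding f_def by (simp add: bij_betw_inv_into_right)
  have iff: "g ` e \<in> image g ` edges F \<longleftrightarrow> e \<in> edges F" if "e \<subseteq> {..<length xs}" for e
  proof
    assume "g ` e \<in> image g ` edges F"
    then obtain e' where e': "e' \<in> edges F" "g ` e = g ` e'" by auto
    moreover have "e' \<subseteq> {..<length xs}" using edge_subset[OF F(1) e'(1)] F(2) by simp
    ultimately have "e = e'"
      using that bij by (metis bij_betw_imp_inj_on inj_on_image_eq_iff)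
    with e' show "e \<in> edges F" by simp
  qed auto
  have "{u, v} \<in> edges G \<longleftrightarrow> {f u, f v} \<in> edges F" if "u \<in> set xs" "v \<in> set xs" for u v
  proof -
    have "{f u, f v} \<subseteq> {..<length xs}" using that bij' by (auto simp: bij_betw_def)
    from iff[OF this] that show ?thesis by (simp add: gf assms(5) flip: g_def)
  qed
  with bij' show ?thesis
    unfolding graph_iso_def using assms by auto
qed

section \<open>Edge lists of the standard graphs and isomorphisms onto them\<close>

lemma simple_path_graph: "simple_graph (path_graph k)"
  by (auto simp: simple_graph_def path_graph_def nsets_def)

lemma edges_path_graph:
  "edges (path_graph 1) = {}"
  "edges (path_graph 2) = {{0, 1}}"
  "edges (path_graph 3) = {{0, 1}, {1, 2}}"
  "edges (path_graph 4) = {{0, 1}, {1, 2}, {2, 3}}"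
  "edges (path_graph 5) = {{0, 1}, {1, 2}, {2, 3}, {3, 4}}"
proof -
  \<comment> \<open>\<open>Suc i < k\<close> turns into \<open>i < k - 1\<close>; truncated
    subtraction keeps this correct for \<open>k = 0\<close>.\<close>
  have *: "edges (path_graph k) = (\<lambda>i. {i, Suc i}) ` {..<k - 1}" for k
    by (auto simp: path_graph_def)
  show
    "edges (path_graph 1) = {}"
    "edges (path_graph 2) = {{0, 1}}"
    "edges (path_graph 3) = {{0, 1}, {1, 2}}"
    "edges (path_graph 4) = {{0, 1}, {1, 2}, {2, 3}}"
    "edges (path_graph 5) = {{0, 1}, {1, 2}, {2, 3}, {3, 4}}"
    unfolding * by (auto simp: lessThan_Suc numeral_eq_Suc)
qed

lemma simple_star_graph: "simple_graph (star_graph k)"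
  by (auto simp: simple_graph_def star_graph_def nsets_def)

lemma edges_star_graph:
  "edges (star_graph 3) = {{0, 1}, {0, 2}, {0, 3}}"
  "edges (star_graph 4) = {{0, 1}, {0, 2}, {0, 3}, {0, 4}}"
proof -
  have *: "edges (star_graph k) = (\<lambda>i. {0, i}) ` {1..k}" for k
    by (auto simp: star_graph_def)
  show
    "edges (star_graph 3) = {{0, 1}, {0, 2}, {0, 3}}"
    "edges (star_graph 4) = {{0, 1}, {0, 2}, {0, 3}, {0, 4}}"
    unfolding * by (auto simp: atLeastAtMostSuc_conv numeral_eq_Suc)
qed

lemma simple_star_plus_graph: "k \<ge> 1 \<Longrightarrow> simple_graph (star_plus_graph k)"
  by (auto simp: simple_graph_def star_plus_graph_def subdivide_edge_def star_graph_def nsets_def)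

lemma edges_star_plus_graph:
  "edges (star_plus_graph 3) = {{0, 1}, {0, 2}, {0, 4}, {3, 4}}"
  "edges (star_plus_graph 4) = {{0, 1}, {0, 2}, {0, 3}, {0, 5}, {4, 5}}"
  by (simp_all add: star_plus_graph_def subdivide_edge_def edges_star_graph
      insert_Diff_if doubleton_eq_iff insert_commute)

lemma simple_cycle_graph_3: "simple_graph (cycle_graph 3)"
  by (auto simp: simple_graph_def cycle_graph_def nsets_def card_insert_if mod_Suc)

lemma edges_cycle_graph_3: "edges (cycle_graph 3) = {{0, 1}, {1, 2}, {2, 0}}"
proof -
  have "edges (cycle_graph 3) = (\<lambda>i. {i, Suc i mod 3}) ` {..<3}"
    by (auto simp: cycle_graph_def)
  moreover have "{..<3} = {0, 1, 2 :: nat}" by auto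
  ultimately show ?thesis by (simp add: numeral_2_eq_2)
qed

lemma vertices_standard:
  "vertices (path_graph k) = {..<k}"
  "vertices (star_graph k) = {..<Suc k}"
  "vertices (star_plus_graph k) = {..<Suc (Suc k)}"
  "vertices (cycle_graph k) = {..<k}"
  by (auto simp: path_graph_def star_graph_def star_plus_graph_def subdivide_edge_def
      cycle_graph_def lessThan_Suc)

lemma graph_iso_path_graph:
  "vertices G = {a} \<Longrightarrow> edges G = {} \<Longrightarrow> graph_iso G (path_graph 1)"
  "distinct [a, b] \<Longrightarrow> vertices G = {a, b} \<Longrightarrow> edges G = {{a, b}}
    \<Longrightarrow> graph_iso G (path_graph 2)"
  "distinct [a, b, c] \<Longrightarrow> vertices G = {a, b, c} \<Longrightarrow> edges G = {{a, b}, {b, c}}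
    \<Longrightarrow> graph_iso G (path_graph 3)"
  "distinct [a, b, c, d] \<Longrightarrow> vertices G = {a, b, c, d} \<Longrightarrow> edges G = {{a, b}, {b, c}, {c, d}}
    \<Longrightarrow> graph_iso G (path_graph 4)"
  "distinct [a, b, c, d, e] \<Longrightarrow> vertices G = {a, b, c, d, e}
    \<Longrightarrow> edges G = {{a, b}, {b, c}, {c, d}, {d, e}} \<Longrightarrow> graph_iso G (path_graph 5)"
  subgoal by (rule graph_iso_nth[OF simple_path_graph, of _ "[a]"])
      (simp_all add: vertices_standard edges_path_graph[unfolded One_nat_def])
  subgoal by (rule graph_iso_nth[OF simple_path_graph, of _ "[a, b]"])
      (simp_all add: vertices_standard edges_path_graph)
  subgoal by (rule graph_iso_nth[OF simple_path_graph, of _ "[a, b, c]"])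
      (simp_all add: vertices_standard edges_path_graph)
  subgoal by (rule graph_iso_nth[OF simple_path_graph, of _ "[a, b, c, d]"])
      (simp_all add: vertices_standard edges_path_graph)
  subgoal by (rule graph_iso_nth[OF simple_path_graph, of _ "[a, b, c, d, e]"])
      (simp_all add: vertices_standard edges_path_graph)
  done

lemma graph_iso_star_graph:
  "distinct [v, a, b, c] \<Longrightarrow> vertices G = {v, a, b, c} \<Longrightarrow> edges G = {{v, a}, {v, b}, {v, c}}
    \<Longrightarrow> graph_iso G (star_graph 3)"
  "distinct [v, a, b, c, d] \<Longrightarrow> vertices G = {v, a, b, c, d}
    \<Longrightarrow> edges G = {{v, a}, {v, b}, {v, c}, {v, d}} \<Longrightarrow> graph_iso G (star_graph 4)"
  subgoal by (rule graph_iso_nth[OF simple_star_graph, of _ "[v, a, b, c]"])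
      (simp_all add: vertices_standard edges_star_graph)
  subgoal by (rule graph_iso_nth[OF simple_star_graph, of _ "[v, a, b, c, d]"])
      (simp_all add: vertices_standard edges_star_graph)
  done

lemma graph_iso_star_plus_graph:
  "distinct [v, a, b, c, w] \<Longrightarrow> vertices G = {v, a, b, c, w}
    \<Longrightarrow> edges G = {{v, a}, {v, b}, {v, c}, {c, w}} \<Longrightarrow> graph_iso G (star_plus_graph 3)"
  "distinct [v, a, b, c, d, w] \<Longrightarrow> vertices G = {v, a, b, c, d, w}
    \<Longrightarrow> edges G = {{v, a}, {v, b}, {v, c}, {v, d}, {d, w}} \<Longrightarrow> graph_iso G (star_plus_graph 4)"
  \<comment> \<open>In \<open>star_plus_graph 3\<close> vertex 3 is the outer end of the subdivided
    edge and 4 the subdividing vertex, so \<open>w\<close> is listed before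
    \<open>c\<close>.\<close>
  subgoal by (rule graph_iso_nth[OF simple_star_plus_graph, of _ "[v, a, b, w, c]"])
      (auto simp: vertices_standard edges_star_plus_graph insert_commute)
  subgoal by (rule graph_iso_nth[OF simple_star_plus_graph, of _ "[v, a, b, c, w, d]"])
      (auto simp: vertices_standard edges_star_plus_graph insert_commute)
  done

lemma graph_iso_cycle_graph_3:
  "distinct [a, b, c] \<Longrightarrow> vertices G = {a, b, c} \<Longrightarrow> edges G = {{a, b}, {b, c}, {c, a}}
    \<Longrightarrow> graph_iso G (cycle_graph 3)"
  by (rule graph_iso_nth[OF simple_cycle_graph_3, of "[a, b, c]"])
    (simp_all add: vertices_standard edges_cycle_graph_3)

section \<open>Rainbow copies as vertex maps, and \<open>rainbow_le\<close> in terms of them\<close>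

text \<open>The map replaces a subgraph together with an isomorphism. No host graph occurs, so the
  notion also makes sense in the infinite complete graph on the natural numbers.\<close>

definition rainbow_copy :: "('b set \<Rightarrow> nat) \<Rightarrow> ('a \<Rightarrow> 'b) \<Rightarrow> 'a sgraph \<Rightarrow> bool" where
  "rainbow_copy c f H \<longleftrightarrow> inj_on f (vertices H) \<and> inj_on (\<lambda>e. c (f ` e)) (edges H)"

lemma rainbow_copy_colors:
  assumes "rainbow_copy c f H" "distinct es" "set es \<subseteq> edges H"
  shows "distinct (map (\<lambda>e. c (f ` e)) es)"
  using assms by (auto simp: rainbow_copy_def distinct_map intro: inj_on_subset)

lemma rainbow_copy_distinct:
  assumes "rainbow_copy c f H" "distinct xs" "set xs \<subseteq> vertices H"
  shows "distinct (map f xs)"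
  using assms by (auto simp: rainbow_copy_def distinct_map intro: inj_on_subset)

text \<open>An isomorphism from a rainbow subgraph to \<open>H\<close> is inverted to give the map;
  conversely the image of \<open>H\<close> under the map is the subgraph.\<close>

lemma not_rainbow_free_iff:
  assumes G: "complete_graph G" and H: "simple_graph H"
  shows "\<not> rainbow_free H G c \<longleftrightarrow> (\<exists>f. rainbow_copy c f H \<and> f ` vertices H \<subseteq> vertices G)"
proof
  assume "\<not> rainbow_free H G c"
  then obtain F g where F: "simple_graph F" "vertices F \<subseteq> vertices G" "rainbow c F"
    and g: "bij_betw g (vertices F) (vertices H)"
      "\<forall>u\<in>vertices F. \<forall>v\<in>vertices F. {u, v} \<in> edges F \<longleftrightarrow> {g u, g v} \<in> edges H"
    by (auto simp: rainbow_free_def subgraph_def graph_iso_def)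
  define f where "f = inv_into (vertices F) g"
  have bij: "bij_betw f (vertices H) (vertices F)"
    unfolding f_def by (rule bij_betw_inv_into[OF g(1)])
  have gf: "g (f u) = u" if "u \<in> vertices H" for u
    using g(1) that unfolding f_def by (simp add: bij_betw_inv_into_right)
  have fE: "f ` e \<in> edges F" if "e \<in> edges H" for e
  proof -
    from that obtain u v where uv: "e = {u, v}" using edgeE[OF H] by blast
    with that have "u \<in> vertices H" "v \<in> vertices H" using edgeD[OF H] by blast+
    with that uv g(2) bij show ?thesis by (simp add: gf bij_betw_apply)
  qed
  have "inj_on (\<lambda>e. c (f ` e)) (edges H)"
  proof (rule inj_onI)
    fix e e' assume e: "e \<in> edges H" "e' \<in> edges H" "c (f ` e) = c (f ` e')"
    then have "f ` e = f ` e'" using F(3) fE by (auto simp: rainbow_def inj_on_def)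
    with e show "e = e'"
      using bij H by (metis bij_betw_def edge_subset inj_on_image_eq_iff)
  qed
  with bij F show "\<exists>f. rainbow_copy c f H \<and> f ` vertices H \<subseteq> vertices G"
    by (auto simp: rainbow_copy_def bij_betw_def)
next
  assume "\<exists>f. rainbow_copy c f H \<and> f ` vertices H \<subseteq> vertices G"
  then obtain f where f: "inj_on f (vertices H)" "inj_on (\<lambda>e. c (f ` e)) (edges H)"
    and sub: "f ` vertices H \<subseteq> vertices G" by (auto simp: rainbow_copy_def)
  define F where "F = \<lparr>vertices = f ` vertices H, edges = image f ` edges H\<rparr>"
  define g where "g = inv_into (vertices H) f"
  have bij: "bij_betw g (vertices F) (vertices H)"
    unfolding g_def F_def using f by (simp add: bij_betw_inv_into inj_on_imp_bij_betw)
  have gf: "g (f u) = u" if "u \<in> vertices H" for u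
    using f(1) that by (simp add: g_def)
  have simp: "simple_graph F"
    unfolding simple_graph_def
  proof
    show "finite (vertices F)" using H by (auto simp: F_def simple_graph_def)
    show "edges F \<subseteq> nsets (vertices F) 2"
    proof
      fix e assume "e \<in> edges F"
      then obtain e' where e': "e' \<in> edges H" "e = f ` e'" by (auto simp: F_def)
      then obtain u v where uv: "e' = {u, v}" "u \<noteq> v" using edgeE[OF H] by blast
      with e' have V: "u \<in> vertices H" "v \<in> vertices H" using edgeD[OF H] by blast+
      with uv f(1) have "f u \<noteq> f v" by (meson inj_onD)
      with e' uv V show "e \<in> nsets (vertices F) 2"
        by (simp add: F_def nsets_def)
    qed
  qed
  \<comment> \<open>Completeness of \<open>G\<close> enters here: every pair of its vertices is an
    edge.\<close>
  have "edges F \<subseteq> edges G"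
    using simp nsets_mono[OF sub] G by (auto simp: simple_graph_def complete_graph_def F_def)
  moreover have "{u, v} \<in> edges F \<longleftrightarrow> {g u, g v} \<in> edges H"
    if uv: "u \<in> vertices F" "v \<in> vertices F" for u v
  proof -
    obtain u' v' where *: "u = f u'" "v = f v'" "u' \<in> vertices H" "v' \<in> vertices H"
      using uv by (auto simp: F_def)
    have "f ` {u', v'} \<in> image f ` edges H \<longleftrightarrow> {u', v'} \<in> edges H"
    proof
      assume "f ` {u', v'} \<in> image f ` edges H"
      then obtain e where e: "e \<in> edges H" "f ` {u', v'} = f ` e" by blast
      then have "{u', v'} = e"
        using f(1) *(3,4) edge_subset[OF H e(1)]
        by (metis inj_on_image_eq_iff insert_subset empty_subsetI)
      with e show "{u', v'} \<in> edges H" by simp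
    qed blast
    then show ?thesis using * by (simp add: gf F_def)
  qed
  moreover have "rainbow c F"
    using f(2) by (auto simp: rainbow_def F_def inj_on_def)
  moreover have "vertices F \<subseteq> vertices G" using sub by (simp add: F_def)
  ultimately show "\<not> rainbow_free H G c"
    unfolding rainbow_free_def subgraph_def graph_iso_def using simp bij by blast
qed

text \<open>Whatever threshold \<open>t\<close> belongs to the relation, the coloring restricted to
  a large initial segment \<open>{..<n}\<close> still shows \<open>t\<close> colors and still
  contains the rainbow copy of \<open>F\<close>. One infinite coloring thus serves for all
  \<open>t\<close>.\<close>

lemma rainbow_le_infinite:
  fixes c :: "nat set \<Rightarrow> nat"
  assumes le: "rainbow_le H F" and simp: "simple_graph H" "simple_graph F"
    and inf: "infinite (c ` nsets UNIV 2)" and g: "rainbow_copy c g F"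
  obtains f where "rainbow_copy c f H"
proof -
  from le obtain t where t: "\<And>(G :: nat sgraph) c. complete_graph G \<Longrightarrow> card (c ` edges G) \<ge> t \<Longrightarrow>
      rainbow_free H G c \<Longrightarrow> rainbow_free F G c"
    unfolding rainbow_le_def by blast
  obtain C where C: "finite C" "card C = t" "C \<subseteq> c ` nsets UNIV 2"
    using infinite_arbitrarily_large[OF inf] by blast
  \<comment> \<open>\<open>T\<close> collects finitely many edges on which the \<open>t\<close>
    chosen colors occur.\<close>
  obtain T where T: "T \<subseteq> nsets UNIV 2" "finite T" "C = c ` T"
    using finite_subset_image[OF C(1,3)] by blast
  have "finite (\<Union>T \<union> g ` vertices F)"
    using T simp by (auto simp: simple_graph_def nsets_def)
  then obtain n where n: "\<Union>T \<union> g ` vertices F \<subseteq> {..<n}"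
    using finite_nat_bounded by blast
  define G where "G = \<lparr>vertices = {..<n}, edges = nsets {..<n} 2\<rparr>"
  have G: "complete_graph G" by (simp add: G_def complete_graph_def)
  have "T \<subseteq> edges G" using T n by (auto simp: G_def nsets_def)
  moreover have "finite (edges G)" by (simp add: G_def finite_imp_finite_nsets)
  ultimately have "card (c ` edges G) \<ge> t"
    using T(3) C(2) by (metis card_mono finite_imageI image_mono)
  moreover have "\<not> rainbow_free F G c"
    using g n not_rainbow_free_iff[OF G simp(2)] by (auto simp: G_def)
  ultimately have "\<not> rainbow_free H G c" using t[OF G] by blast
  then show thesis using not_rainbow_free_iff[OF G simp(1)] that by blast
qed

text \<open>The copy of \<open>F\<close> may use host edges outside the copy of \<open>H\<close>, as
  long as it stays on the same vertices. The implication then holds in every complete graph, so the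
  threshold 1 suffices.\<close>

lemma rainbow_le_if:
  assumes simp: "simple_graph H" "simple_graph F"
    and "\<And>c f. rainbow_copy c (f :: 'a \<Rightarrow> nat) H \<Longrightarrow>
      \<exists>g. rainbow_copy c g F \<and> g ` vertices F \<subseteq> f ` vertices H"
  shows "rainbow_le F (H :: 'a sgraph)"
  unfolding rainbow_le_def
proof (intro exI[of _ 1] conjI allI impI)
  fix G :: "nat sgraph" and c
  assume G: "complete_graph G" and F: "rainbow_free F G c"
  show "rainbow_free H G c"
  proof (rule ccontr)
    assume "\<not> rainbow_free H G c"
    then obtain f where f: "rainbow_copy c f H" "f ` vertices H \<subseteq> vertices G"
      using not_rainbow_free_iff[OF G simp(1)] by blast
    then obtain g where g: "rainbow_copy c g F" "g ` vertices F \<subseteq> f ` vertices H"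
      using assms(3)[OF f(1)] by auto
    have "g ` vertices F \<subseteq> vertices G" using g(2) f(2) by (rule subset_trans)
    with g(1) have "\<not> rainbow_free F G c" by (auto simp: not_rainbow_free_iff[OF G simp(2)])
    with F show False by simp
  qed
qed simp

section \<open>Rainbow paths, stars and triangles from explicit vertices\<close>

lemma nth_image_lessThan: "nth xs ` {..<length xs} = set xs"
  by (auto simp: in_set_conv_nth)

text \<open>\<open>W\<close> serves two purposes: it is the vertex set of a given copy of
  \<open>H\<close> when \<open>rainbow_le_if\<close> is applied, and \<open>UNIV\<close> for the
  concrete colorings.\<close>

lemma rainbow_copy_P5:
  assumes "distinct [a, b, c, d, e]"
    and "distinct [k {a, b}, k {b, c}, k {c, d}, k {d, e}]"
    and "{a, b, c, d, e} \<subseteq> W"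
  shows "\<exists>g. rainbow_copy k g (path_graph 5) \<and> g ` vertices (path_graph 5) \<subseteq> W"
proof (intro exI conjI)
  show "rainbow_copy k (nth [a, b, c, d, e]) (path_graph 5)"
    unfolding rainbow_copy_def
    using assms(1,2) by (simp add: vertices_standard edges_path_graph inj_on_nth
        insert_Diff_if doubleton_eq_iff)
  show "nth [a, b, c, d, e] ` vertices (path_graph 5) \<subseteq> W"
    using assms(3) nth_image_lessThan[of "[a, b, c, d, e]"]
    by (simp add: vertices_standard numeral_eq_Suc)
qed

lemma rainbow_copy_K14:
  assumes "distinct [v, a, b, c, d]"
    and "distinct [k {v, a}, k {v, b}, k {v, c}, k {v, d}]"
    and "{v, a, b, c, d} \<subseteq> W"
  shows "\<exists>g. rainbow_copy k g (star_graph 4) \<and> g ` vertices (star_graph 4) \<subseteq> W"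
proof (intro exI conjI)
  show "rainbow_copy k (nth [v, a, b, c, d]) (star_graph 4)"
    unfolding rainbow_copy_def
    using assms(1,2) by (simp add: vertices_standard edges_star_graph inj_on_nth
        insert_Diff_if doubleton_eq_iff)
  show "nth [v, a, b, c, d] ` vertices (star_graph 4) \<subseteq> W"
    using assms(3) nth_image_lessThan[of "[v, a, b, c, d]"]
    by (simp add: vertices_standard numeral_eq_Suc)
qed

lemma rainbow_copy_C3:
  assumes "distinct [a, b, c]"
    and "distinct [k {a, b}, k {b, c}, k {c, a}]"
    and "{a, b, c} \<subseteq> W"
  shows "\<exists>g. rainbow_copy k g (cycle_graph 3) \<and> g ` vertices (cycle_graph 3) \<subseteq> W"
proof (intro exI conjI)
  show "rainbow_copy k (nth [a, b, c]) (cycle_graph 3)"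
    unfolding rainbow_copy_def
    using assms(1,2) by (simp add: vertices_standard edges_cycle_graph_3 inj_on_nth
        insert_Diff_if doubleton_eq_iff)
  show "nth [a, b, c] ` vertices (cycle_graph 3) \<subseteq> W"
    using assms(3) nth_image_lessThan[of "[a, b, c]"]
    by (simp add: vertices_standard numeral_eq_Suc)
qed

section \<open>Five configurations, one of which must occur in \<open>H\<close>\<close>

text \<open>These configurations are subgraphs, not necessarily induced ones.\<close>

definition has_K14 :: "'a sgraph \<Rightarrow> bool" where
  "has_K14 H \<longleftrightarrow> (\<exists>v a b c d. distinct [v, a, b, c, d] \<and>
     {{v, a}, {v, b}, {v, c}, {v, d}} \<subseteq> edges H)"

definition has_P5 :: "'a sgraph \<Rightarrow> bool" where
  "has_P5 H \<longleftrightarrow> (\<exists>a b c d e. distinct [a, b, c, d, e] \<and>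
     {{a, b}, {b, c}, {c, d}, {d, e}} \<subseteq> edges H)"

definition has_C3 :: "'a sgraph \<Rightarrow> bool" where
  "has_C3 H \<longleftrightarrow> (\<exists>a b c. distinct [a, b, c] \<and> {{a, b}, {b, c}, {c, a}} \<subseteq> edges H)"

definition has_C4 :: "'a sgraph \<Rightarrow> bool" where
  "has_C4 H \<longleftrightarrow> (\<exists>a b c d. distinct [a, b, c, d] \<and>
     {{a, b}, {b, c}, {c, d}, {d, a}} \<subseteq> edges H)"

definition has_double_star :: "'a sgraph \<Rightarrow> bool" where
  "has_double_star H \<longleftrightarrow> (\<exists>u v a b c d. distinct [u, v, a, b, c, d] \<and>
     {{u, v}, {u, a}, {u, b}, {v, c}, {v, d}} \<subseteq> edges H)"

text \<open>Suppose none occurs. If some vertex has three neighbours, they are all its neighbours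
  and at most one further edge can hang on them, which leaves only the two excluded stars. Otherwise
  all degrees are at most two, and a longest path, having at most four vertices, is the whole
  graph.\<close>

lemma forbidden_subgraph_cases:
  assumes H: "simple_graph H" "connected_graph H"
    and path: "\<And>k. k \<in> {1, 2, 3, 4} \<Longrightarrow> \<not> graph_iso H (path_graph k)"
    and star: "\<not> graph_iso H (star_graph 3)" "\<not> graph_iso H (star_plus_graph 3)"
  shows "has_K14 H \<or> has_P5 H \<or> has_C3 H \<or> has_C4 H \<or> has_double_star H"
proof (rule ccontr)
  assume none: "\<not> ?thesis"
  define adj where "adj u v \<longleftrightarrow> {u, v} \<in> edges H" for u v
  have sym: "adj v u" if "adj u v" for u v using that by (simp add: adj_def insert_commute)
  have adjD: "u \<noteq> v" "u \<in> vertices H" "v \<in> vertices H" if "adj u v" for u v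
    using edgeD[OF H(1)] that by (auto simp: adj_def)
  have K14: False if "distinct [v, a, b, c, d]" "adj v a" "adj v b" "adj v c" "adj v d" for v a b c d
    using none that unfolding has_K14_def adj_def by blast
  have P5: False if "distinct [a, b, c, d, e]" "adj a b" "adj b c" "adj c d" "adj d e" for a b c d e
    using none that unfolding has_P5_def adj_def by blast
  have C3: False if "adj a b" "adj b c" "adj c a" for a b c
  proof -
    have "distinct [a, b, c]" using that adjD by auto
    then show False using none that unfolding has_C3_def adj_def by blast
  qed
  have C4: False if "distinct [a, b, c, d]" "adj a b" "adj b c" "adj c d" "adj d a" for a b c d
    using none that unfolding has_C4_def adj_def by blast
  have S22: False if "distinct [u, v, a, b, c, d]" "adj u v" "adj u a" "adj u b" "adj v c" "adj v d"
    for u v a b c d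
    using none that unfolding has_double_star_def adj_def by blast
  show False
  proof (cases "\<exists>v a b c. distinct [a, b, c] \<and> adj v a \<and> adj v b \<and> adj v c")
    case True
    then obtain v a b c where v: "distinct [a, b, c]" "adj v a" "adj v b" "adj v c" by blast
    have dist: "distinct [v, a, b, c]" using v adjD by auto
    have N: "x \<in> {a, b, c}" if "adj v x" for x
    proof (rule ccontr)
      assume "x \<notin> {a, b, c}"
      then show False using K14[of v a b c x] v that adjD(1)[OF that] dist by auto
    qed
    have adjv: "adj v p" if "p \<in> {a, b, c}" for p using that v by auto
    \<comment> \<open>A further neighbour of \<open>p\<close> among \<open>a\<close>,
      \<open>b\<close>, \<open>c\<close> would close a triangle with \<open>v\<close>.\<close>
    have outside: "w \<notin> {v, a, b, c}" if "p \<in> {a, b, c}" "adj p w" "w \<noteq> v" for p w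
      using that C3[of v p w] adjv sym by blast
    \<comment> \<open>A second neighbour \<open>z\<close> of \<open>w\<close> gives the 4-cycle
      \<open>v p w z\<close> if it is adjacent to \<open>v\<close>, and otherwise the path
      \<open>z w p v q\<close>.\<close>
    have leaf: "z = p" if p: "p \<in> {a, b, c}" "adj p w" "w \<noteq> v" and z: "adj w z" for p w z
    proof (rule ccontr)
      assume "z \<noteq> p"
      have w: "w \<notin> {v, a, b, c}" using outside p by blast
      then have "z \<noteq> v" using N sym z by blast
      show False
      proof (cases "z \<in> {a, b, c}")
        case True
        then show False
          using C4[of v p w z] adjv[of p] adjv[of z] p z sym w \<open>z \<noteq> p\<close> \<open>z \<noteq> v\<close> adjD by auto
      next
        case False
        obtain q where "q \<in> {a, b, c}" "q \<noteq> p" using v(1) by auto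
        then show False
          using P5[of z w p v q] adjv[of p] adjv[of q] p z sym w \<open>z \<noteq> p\<close> \<open>z \<noteq> v\<close> False adjD by auto
      qed
    qed
    \<comment> \<open>Two further edges at the same \<open>p\<close> make a double star with centres
      \<open>v\<close> and \<open>p\<close>; at different vertices \<open>p\<close> and
      \<open>q\<close> they make the path \<open>w p v q w'\<close>.\<close>
    have unique: "p = q \<and> w = w'"
      if p: "p \<in> {a, b, c}" "adj p w" "w \<noteq> v" and q: "q \<in> {a, b, c}" "adj q w'" "w' \<noteq> v"
      for p q w w'
    proof -
      have w: "w \<notin> {v, a, b, c}" "w' \<notin> {v, a, b, c}" using outside p q by blast+
      show ?thesis
      proof (cases "p = q")
        case True
        obtain x y where xy: "x \<in> {a, b, c}" "y \<in> {a, b, c}" "distinct [x, y, p]"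
          using v(1) p(1) by auto
        show ?thesis
          using S22[of v p x y w w'] xy adjv p q w True dist by auto
      next
        case False
        then have "w \<noteq> w'" using leaf[OF p, of q] sym[OF q(2)] by blast
        then show ?thesis
          using P5[of w p v q w'] False p q w adjv[of p] adjv[of q] sym dist by auto
      qed
    qed
    show False
    proof (cases "\<exists>p\<in>{a, b, c}. \<exists>w. adj p w \<and> w \<noteq> v")
      case False
      have "vertices H = {v, a, b, c} \<and> edges H = {{v, a}, {v, b}, {v, c}}"
      proof (rule connected_eq[OF H, of v])
        fix u w assume uw: "u \<in> {v, a, b, c}" "{u, w} \<in> edges H"
        show "{u, w} \<in> {{v, a}, {v, b}, {v, c}}"
        proof (cases "u = v")
          case True
          then show ?thesis using N uw by (auto simp: adj_def)
        next
          case u: False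
          then have "w = v" using False uw by (auto simp: adj_def)
          then show ?thesis using u uw by (auto simp: insert_commute)
        qed
      qed (use v adjD in \<open>auto simp: adj_def\<close>)
      with graph_iso_star_graph(1)[OF dist] star show False by blast
    next
      case True
      then obtain p w where p: "p \<in> {a, b, c}" "adj p w" "w \<noteq> v" by blast
      obtain x y where xy: "{a, b, c} = {x, y, p}" "distinct [x, y, p]"
      proof -
        have "p = a \<or> p = b \<or> p = c" using p(1) by blast
        then show thesis using that[of b c] that[of a c] that[of a b] v(1)
          by (elim disjE) (auto simp: insert_commute)
      qed
      have w: "w \<notin> {v, a, b, c}" using outside p by blast
      have adj: "adj v x" "adj v y" "adj v p" using adjv xy by blast+
      have "vertices H = {v, x, y, p, w} \<and> edges H = {{v, x}, {v, y}, {v, p}, {p, w}}"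
      proof (rule connected_eq[OF H, of v])
        fix u z assume uz: "u \<in> {v, x, y, p, w}" "{u, z} \<in> edges H"
        consider "u = v" | "u = w" | "u \<in> {a, b, c}" "z = v" | "u \<in> {a, b, c}" "z \<noteq> v"
          using uz xy by blast
        then show "{u, z} \<in> {{v, x}, {v, y}, {v, p}, {p, w}}"
        proof cases
          case 1
          then show ?thesis using N[of z] uz xy by (auto simp: adj_def)
        next
          case 2
          then show ?thesis using leaf[OF p, of z] uz by (auto simp: adj_def insert_commute)
        next
          case 3
          then show ?thesis using xy by (auto simp: insert_commute)
        next
          case 4
          then have "u = p \<and> z = w" using unique[of u z p w] p uz by (auto simp: adj_def)
          then show ?thesis by simp
        qed
      qed (use adj p adjD in \<open>auto simp: adj_def\<close>)
      moreover have "distinct [v, x, y, p, w]" using w xy dist p by auto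
      ultimately show False using graph_iso_star_plus_graph(1)[of v x y p w H] star(2) by blast
    qed
  next
    case False
    then have deg: False if "distinct [a, b, c]" "adj v a" "adj v b" "adj v c" for v a b c
      using that by blast
    show False
    \<comment> \<open>From here on a longest path is fixed: four, three, two vertices or
      one.\<close>
    proof (cases "\<exists>a b c d. distinct [a, b, c, d] \<and> adj a b \<and> adj b c \<and> adj c d")
      case True
      then obtain a b c d where d: "distinct [a, b, c, d]" and adj: "adj a b" "adj b c" "adj c d"
        by blast
      \<comment> \<open>An additional edge at the end \<open>a\<close> leads to \<open>c\<close>
        (triangle), to \<open>d\<close> (4-cycle) or to a new vertex (path on five
        vertices).\<close>
      have end1: "z = b" if "distinct [a, b, c, d]" "adj a b" "adj b c" "adj c d" "adj a z"
        for a b c d z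
      proof (rule ccontr)
        assume "z \<noteq> b"
        moreover have "z \<noteq> c" using C3[of a b c] that sym by blast
        moreover have "z \<noteq> d" using C4[of a b c d] that sym by blast
        ultimately have "distinct [z, a, b, c, d]"
          using that(1) adjD(1)[OF that(5)] by auto
        then show False using P5[of z a b c d] that sym by blast
      qed
      have "vertices H = {a, b, c, d} \<and> edges H = {{a, b}, {b, c}, {c, d}}"
      proof (rule connected_eq[OF H, of a])
        fix u z assume uz: "u \<in> {a, b, c, d}" "{u, z} \<in> edges H"
        then have "adj u z" by (simp add: adj_def)
        consider "u = a" | "u = b" | "u = c" | "u = d" using uz by blast
        then show "{u, z} \<in> {{a, b}, {b, c}, {c, d}}"
        proof cases
          case 1
          then show ?thesis using end1[OF d adj] \<open>adj u z\<close> by auto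
        next
          case 2
          then have "z \<in> {a, c}" using deg[of a c z b] adj sym d \<open>adj u z\<close> by auto
          then show ?thesis using 2 by (auto simp: insert_commute)
        next
          case 3
          then have "z \<in> {b, d}" using deg[of b d z c] adj sym d \<open>adj u z\<close> by auto
          then show ?thesis using 3 by (auto simp: insert_commute)
        next
          case 4
          then show ?thesis using end1[of d c b a z] d adj sym \<open>adj u z\<close>
            by (auto simp: insert_commute)
        qed
      qed (use adj adjD in \<open>auto simp: adj_def\<close>)
      with graph_iso_path_graph(4)[OF d, of H] path[of 4] show False by simp
    next
      case noP4: False
      show False
      proof (cases "\<exists>a b c. distinct [a, b, c] \<and> adj a b \<and> adj b c")
        case True
        then obtain a b c where d: "distinct [a, b, c]" and adj: "adj a b" "adj b c" by blast
        have "vertices H = {a, b, c} \<and> edges H = {{a, b}, {b, c}}"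
        proof (rule connected_eq[OF H, of a])
          fix u z assume uz: "u \<in> {a, b, c}" "{u, z} \<in> edges H"
          then have "adj u z" by (simp add: adj_def)
          consider "u = a" | "u = b" | "u = c" using uz by blast
          then show "{u, z} \<in> {{a, b}, {b, c}}"
          proof cases
            case 1
            have "z = b"
            proof (rule ccontr)
              assume "z \<noteq> b"
              moreover have "z \<noteq> c" using C3[of a b c] adj sym \<open>adj u z\<close> 1 by blast
              ultimately have "distinct [z, a, b, c]" using d adjD(1)[OF \<open>adj u z\<close>] 1 by auto
              then show False using noP4 adj sym \<open>adj u z\<close> 1 by blast
            qed
            then show ?thesis using 1 by auto
          next
            case 2
            then have "z \<in> {a, c}" using deg[of a c z b] adj sym d \<open>adj u z\<close> by auto
            then show ?thesis using 2 by (auto simp: insert_commute)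
          next
            case 3
            have "z = b"
            proof (rule ccontr)
              assume "z \<noteq> b"
              moreover have "z \<noteq> a" using C3[of a b c] adj sym \<open>adj u z\<close> 3 by blast
              ultimately have "distinct [a, b, c, z]" using d adjD(1)[OF \<open>adj u z\<close>] 3 by auto
              then show False using noP4 adj \<open>adj u z\<close> 3 by blast
            qed
            then show ?thesis using 3 by (auto simp: insert_commute)
          qed
        qed (use adj adjD in \<open>auto simp: adj_def\<close>)
        with graph_iso_path_graph(3)[OF d, of H] path[of 3] show False by simp
      next
        case noP3: False
        show False
        proof (cases "\<exists>a b. adj a b")
          case True
          then obtain a b where adj: "adj a b" by blast
          have "vertices H = {a, b} \<and> edges H = {{a, b}}"
          proof (rule connected_eq[OF H, of a])
            fix u z assume uz: "u \<in> {a, b}" "{u, z} \<in> edges H"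
            then have "adj u z" by (simp add: adj_def)
            have "z \<in> {a, b}"
            proof (rule ccontr)
              assume "z \<notin> {a, b}"
              then have "distinct [a, b, z]" "distinct [b, a, z]" using adjD(1)[OF adj] by auto
              then show False using noP3 adj sym \<open>adj u z\<close> uz by blast
            qed
            then show "{u, z} \<in> {{a, b}}" using uz adjD(1)[OF \<open>adj u z\<close>]
              by (auto simp: insert_commute)
          qed (use adj adjD in \<open>auto simp: adj_def\<close>)
          moreover have "distinct [a, b]" using adjD(1)[OF adj] by simp
          ultimately show False using graph_iso_path_graph(2)[of a b H] path[of 2] by simp
        next
          case noedge: False
          obtain a where a: "a \<in> vertices H" using H(2) by (auto simp: connected_graph_def)
          have "vertices H = {a} \<and> edges H = {}"
            by (rule connected_eq[OF H, of a]; use a noedge in \<open>auto simp: adj_def\<close>)+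
          then show False using graph_iso_path_graph(1)[of H a] path[of 1] by simp
        qed
      qed
    qed
  qed
qed

section \<open>Configurations inside rainbow copies, and assertion (1)\<close>

text \<open>This lemma and its four analogues turn a configuration in \<open>H\<close> into
  distinctness statements about the images and their colors, the only form in which the colorings
  are analysed later.\<close>

lemma has_K14_rainbow_copy:
  assumes H: "simple_graph H" "has_K14 H" and f: "rainbow_copy k f H"
  obtains v a b c d where
    "distinct [v, a, b, c, d]" "{{v, a}, {v, b}, {v, c}, {v, d}} \<subseteq> edges H"
    "{v, a, b, c, d} \<subseteq> vertices H" "distinct [f v, f a, f b, f c, f d]"
    "distinct [k {f v, f a}, k {f v, f b}, k {f v, f c}, k {f v, f d}]"
proof -
  obtain v a b c d where dist: "distinct [v, a, b, c, d]"
    and E: "{{v, a}, {v, b}, {v, c}, {v, d}} \<subseteq> edges H"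
    using H(2) unfolding has_K14_def by (elim exE conjE) (rule that)
  have V: "{v, a, b, c, d} \<subseteq> vertices H"
    using Union_subset_vertices[OF H(1) E] by simp
  have f_dist: "distinct [f v, f a, f b, f c, f d]"
    using rainbow_copy_distinct[OF f dist] V by simp
  have es: "distinct [{v, a}, {v, b}, {v, c}, {v, d}]"
    using dist by (auto simp: doubleton_eq_iff)
  have col: "distinct [k {f v, f a}, k {f v, f b}, k {f v, f c}, k {f v, f d}]"
    using rainbow_copy_colors[OF f es] E by simp
  show thesis by (rule that[OF dist E V f_dist col])
qed

lemma has_P5_rainbow_copy:
  assumes H: "simple_graph H" "has_P5 H" and f: "rainbow_copy k f H"
  obtains a b c d e where
    "distinct [a, b, c, d, e]" "{{a, b}, {b, c}, {c, d}, {d, e}} \<subseteq> edges H"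
    "{a, b, c, d, e} \<subseteq> vertices H" "distinct [f a, f b, f c, f d, f e]"
    "distinct [k {f a, f b}, k {f b, f c}, k {f c, f d}, k {f d, f e}]"
proof -
  obtain a b c d e where dist: "distinct [a, b, c, d, e]"
    and E: "{{a, b}, {b, c}, {c, d}, {d, e}} \<subseteq> edges H"
    using H(2) unfolding has_P5_def by (elim exE conjE) (rule that)
  have V: "{a, b, c, d, e} \<subseteq> vertices H"
    using Union_subset_vertices[OF H(1) E] by simp
  have f_dist: "distinct [f a, f b, f c, f d, f e]"
    using rainbow_copy_distinct[OF f dist] V by simp
  have es: "distinct [{a, b}, {b, c}, {c, d}, {d, e}]"
    using dist by (auto simp: doubleton_eq_iff)
  have col: "distinct [k {f a, f b}, k {f b, f c}, k {f c, f d}, k {f d, f e}]"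
    using rainbow_copy_colors[OF f es] E by simp
  show thesis by (rule that[OF dist E V f_dist col])
qed

lemma has_C3_rainbow_copy:
  assumes H: "simple_graph H" "has_C3 H" and f: "rainbow_copy k f H"
  obtains a b c where
    "distinct [a, b, c]" "{{a, b}, {b, c}, {c, a}} \<subseteq> edges H"
    "{a, b, c} \<subseteq> vertices H" "distinct [f a, f b, f c]"
    "distinct [k {f a, f b}, k {f b, f c}, k {f c, f a}]"
proof -
  obtain a b c where dist: "distinct [a, b, c]"
    and E: "{{a, b}, {b, c}, {c, a}} \<subseteq> edges H"
    using H(2) unfolding has_C3_def by (elim exE conjE) (rule that)
  have V: "{a, b, c} \<subseteq> vertices H"
    using Union_subset_vertices[OF H(1) E] by simp
  have f_dist: "distinct [f a, f b, f c]"
    using rainbow_copy_distinct[OF f dist] V by simp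
  have es: "distinct [{a, b}, {b, c}, {c, a}]"
    using dist by (auto simp: doubleton_eq_iff)
  have col: "distinct [k {f a, f b}, k {f b, f c}, k {f c, f a}]"
    using rainbow_copy_colors[OF f es] E by simp
  show thesis by (rule that[OF dist E V f_dist col])
qed

lemma has_C4_rainbow_copy:
  assumes H: "simple_graph H" "has_C4 H" and f: "rainbow_copy k f H"
  obtains a b c d where
    "distinct [a, b, c, d]" "{{a, b}, {b, c}, {c, d}, {d, a}} \<subseteq> edges H"
    "{a, b, c, d} \<subseteq> vertices H" "distinct [f a, f b, f c, f d]"
    "distinct [k {f a, f b}, k {f b, f c}, k {f c, f d}, k {f d, f a}]"
proof -
  obtain a b c d where dist: "distinct [a, b, c, d]"
    and E: "{{a, b}, {b, c}, {c, d}, {d, a}} \<subseteq> edges H"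
    using H(2) unfolding has_C4_def by (elim exE conjE) (rule that)
  have V: "{a, b, c, d} \<subseteq> vertices H"
    using Union_subset_vertices[OF H(1) E] by simp
  have f_dist: "distinct [f a, f b, f c, f d]"
    using rainbow_copy_distinct[OF f dist] V by simp
  have es: "distinct [{a, b}, {b, c}, {c, d}, {d, a}]"
    using dist by (auto simp: doubleton_eq_iff)
  have col: "distinct [k {f a, f b}, k {f b, f c}, k {f c, f d}, k {f d, f a}]"
    using rainbow_copy_colors[OF f es] E by simp
  show thesis by (rule that[OF dist E V f_dist col])
qed

lemma has_double_star_rainbow_copy:
  assumes H: "simple_graph H" "has_double_star H" and f: "rainbow_copy k f H"
  obtains u v a b c d where
    "distinct [u, v, a, b, c, d]" "{{u, v}, {u, a}, {u, b}, {v, c}, {v, d}} \<subseteq> edges H"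
    "{u, v, a, b, c, d} \<subseteq> vertices H" "distinct [f u, f v, f a, f b, f c, f d]"
    "distinct [k {f u, f v}, k {f u, f a}, k {f u, f b}, k {f v, f c}, k {f v, f d}]"
proof -
  obtain u v a b c d where dist: "distinct [u, v, a, b, c, d]"
    and E: "{{u, v}, {u, a}, {u, b}, {v, c}, {v, d}} \<subseteq> edges H"
    using H(2) unfolding has_double_star_def by (elim exE conjE) (rule that)
  have V: "{u, v, a, b, c, d} \<subseteq> vertices H"
    using Union_subset_vertices[OF H(1) E] by simp
  have f_dist: "distinct [f u, f v, f a, f b, f c, f d]"
    using rainbow_copy_distinct[OF f dist] V by simp
  have es: "distinct [{u, v}, {u, a}, {u, b}, {v, c}, {v, d}]"
    using dist by (auto simp: doubleton_eq_iff)
  have col: "distinct [k {f u, f v}, k {f u, f a}, k {f u, f b}, k {f v, f c}, k {f v, f d}]"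
    using rainbow_copy_colors[OF f es] E by simp
  show thesis by (rule that[OF dist E V f_dist col])
qed

lemma has_K14_imp_rainbow_le:
  assumes H: "simple_graph H" "has_K14 H"
  shows "rainbow_le (star_graph 4) H"
proof (rule rainbow_le_if[OF H(1) simple_star_graph])
  fix k and f :: "'a \<Rightarrow> nat" assume f: "rainbow_copy k f H"
  from has_K14_rainbow_copy[OF H f] obtain v a b c d
    where V: "{v, a, b, c, d} \<subseteq> vertices H" and f_dist: "distinct [f v, f a, f b, f c, f d]"
      and col: "distinct [k {f v, f a}, k {f v, f b}, k {f v, f c}, k {f v, f d}]" .
  show "\<exists>g. rainbow_copy k g (star_graph 4) \<and> g ` vertices (star_graph 4) \<subseteq> f ` vertices H"
    by (rule rainbow_copy_K14[OF f_dist col]) (use V in auto)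
qed

lemma has_P5_imp_rainbow_le:
  assumes H: "simple_graph H" "has_P5 H"
  shows "rainbow_le (path_graph 5) H"
proof (rule rainbow_le_if[OF H(1) simple_path_graph])
  fix k and f :: "'a \<Rightarrow> nat" assume f: "rainbow_copy k f H"
  from has_P5_rainbow_copy[OF H f] obtain a b c d e
    where V: "{a, b, c, d, e} \<subseteq> vertices H" and f_dist: "distinct [f a, f b, f c, f d, f e]"
      and col: "distinct [k {f a, f b}, k {f b, f c}, k {f c, f d}, k {f d, f e}]" .
  show "\<exists>g. rainbow_copy k g (path_graph 5) \<and> g ` vertices (path_graph 5) \<subseteq> f ` vertices H"
    by (rule rainbow_copy_P5[OF f_dist col]) (use V in auto)
qed

lemma has_C3_imp_rainbow_le:
  assumes H: "simple_graph H" "has_C3 H"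
  shows "rainbow_le (cycle_graph 3) H"
proof (rule rainbow_le_if[OF H(1) simple_cycle_graph_3])
  fix k and f :: "'a \<Rightarrow> nat" assume f: "rainbow_copy k f H"
  from has_C3_rainbow_copy[OF H f] obtain a b c
    where V: "{a, b, c} \<subseteq> vertices H" and f_dist: "distinct [f a, f b, f c]"
      and col: "distinct [k {f a, f b}, k {f b, f c}, k {f c, f a}]" .
  show "\<exists>g. rainbow_copy k g (cycle_graph 3) \<and> g ` vertices (cycle_graph 3) \<subseteq> f ` vertices H"
    by (rule rainbow_copy_C3[OF f_dist col]) (use V in auto)
qed

text \<open>Either chord of a rainbow 4-cycle completes a rainbow triangle.\<close>

lemma has_C4_imp_rainbow_le:
  assumes H: "simple_graph H" "has_C4 H"
  shows "rainbow_le (cycle_graph 3) H"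
proof (rule rainbow_le_if[OF H(1) simple_cycle_graph_3])
  fix k and f :: "'a \<Rightarrow> nat" assume f: "rainbow_copy k f H"
  from has_C4_rainbow_copy[OF H f] obtain a b c d
    where V: "{a, b, c, d} \<subseteq> vertices H" and f_dist: "distinct [f a, f b, f c, f d]"
      and col: "distinct [k {f a, f b}, k {f b, f c}, k {f c, f d}, k {f d, f a}]" .
  show "\<exists>g. rainbow_copy k g (cycle_graph 3) \<and> g ` vertices (cycle_graph 3) \<subseteq> f ` vertices H"
  \<comment> \<open>The chord splits the cycle into two triangles. A color repeated from one of them
    is absent from the other.\<close>
  proof (cases "k {f c, f a} \<in> {k {f a, f b}, k {f b, f c}}")
    case True
    then have *: "distinct [k {f c, f d}, k {f d, f a}, k {f a, f c}]"
      using col by (auto simp: insert_commute)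
    show ?thesis by (rule rainbow_copy_C3[OF _ *]) (use f_dist V in auto)
  next
    case False
    then have *: "distinct [k {f a, f b}, k {f b, f c}, k {f c, f a}]"
      using col by auto
    show ?thesis by (rule rainbow_copy_C3[OF _ *]) (use f_dist V in auto)
  qed
qed

text \<open>With \<open>u\<close>, \<open>v\<close> the centres and \<open>a\<close>, \<open>c\<close> leaves at \<open>u\<close>, \<open>v\<close>, no color of the edge
  \<open>{a, c}\<close> avoids a rainbow \<open>P\<^sub>5\<close> through it.\<close>

lemma has_double_star_imp_rainbow_le:
  assumes H: "simple_graph H" "has_double_star H"
  shows "rainbow_le (path_graph 5) H"
proof (rule rainbow_le_if[OF H(1) simple_path_graph])
  fix k and f :: "'a \<Rightarrow> nat" assume f: "rainbow_copy k f H"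
  from has_double_star_rainbow_copy[OF H f] obtain u v a b c d
    where V: "{u, v, a, b, c, d} \<subseteq> vertices H" and f_dist: "distinct [f u, f v, f a, f b, f c, f d]"
      and col: "distinct [k {f u, f v}, k {f u, f a}, k {f u, f b}, k {f v, f c}, k {f v, f d}]" .
  show "\<exists>g. rainbow_copy k g (path_graph 5) \<and> g ` vertices (path_graph 5) \<subseteq> f ` vertices H"
  proof -
    have swap: "{f b, f u} = {f u, f b}" "{f c, f v} = {f v, f c}" "{f d, f v} = {f v, f d}"
      "{f c, f a} = {f a, f c}" "{f a, f u} = {f u, f a}" "{f v, f u} = {f u, f v}"
      by auto
    let ?x = "k {f a, f c}"
    \<comment> \<open>If the color of \<open>{a, c}\<close> repeats that of \<open>{u, b}\<close>,
      \<open>{u, a}\<close> or \<open>{v, c}\<close>, the chosen path runs through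
      \<open>{a, c}\<close> and omits the edge with the repeated color.\<close>
    consider "?x \<notin> {k {f u, f a}, k {f u, f b}, k {f v, f c}}"
      | "?x = k {f u, f b}" | "?x = k {f u, f a}" | "?x = k {f v, f c}"
      by blast
    then show ?thesis
    proof cases
      case 1
      have *: "distinct [k {f b, f u}, k {f u, f a}, k {f a, f c}, k {f c, f v}]"
        using col 1 unfolding swap using [[linarith_neq_limit = 0]] by auto
      show ?thesis by (rule rainbow_copy_P5[OF _ *]) (use f_dist V in auto)
    next
      case 2
      have *: "distinct [k {f d, f v}, k {f v, f c}, k {f c, f a}, k {f a, f u}]"
        using col 2 unfolding swap using [[linarith_neq_limit = 0]] by auto
      show ?thesis by (rule rainbow_copy_P5[OF _ *]) (use f_dist V in auto)
    next
      case 3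
      have *: "distinct [k {f a, f c}, k {f c, f v}, k {f v, f u}, k {f u, f b}]"
        using col 3 unfolding swap using [[linarith_neq_limit = 0]] by auto
      show ?thesis by (rule rainbow_copy_P5[OF _ *]) (use f_dist V in auto)
    next
      case 4
      have *: "distinct [k {f c, f a}, k {f a, f u}, k {f u, f v}, k {f v, f d}]"
        using col 4 unfolding swap using [[linarith_neq_limit = 0]] by auto
      show ?thesis by (rule rainbow_copy_P5[OF _ *]) (use f_dist V in auto)
    qed
  qed
qed

section \<open>Four colorings with infinitely many colors\<close>

lemma infinite_coloringI:
  fixes c :: "nat set \<Rightarrow> nat"
  assumes "\<And>m. \<exists>x y. x \<noteq> y \<and> m \<le> c {x, y}"
  shows "infinite (c ` nsets UNIV 2)"
  unfolding infinite_nat_iff_unbounded_le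
proof
  fix m
  obtain x y where "x \<noteq> y" "m \<le> c {x, y}" using assms by blast
  moreover from this have "{x, y} \<in> nsets UNIV 2" by (simp add: nsets_def)
  ultimately show "\<exists>n\<ge>m. n \<in> c ` nsets UNIV 2" by blast
qed

lemma infinite_Min_coloring: "infinite (Min ` nsets (UNIV :: nat set) 2)"
proof (rule infinite_coloringI)
  show "\<exists>x y. x \<noteq> y \<and> m \<le> Min {x, y}" for m :: nat
    by (intro exI[of _ m] exI[of _ "Suc m"]) simp
qed

text \<open>A rainbow star centred at 0. On its edges the maximum is the other endpoint and hence
  positive, so color 0 is reserved for all remaining edges.\<close>

definition hub_coloring :: "nat set \<Rightarrow> nat" where
  "hub_coloring e = (if 0 \<in> e then Max e else 0)"

lemma hub_coloring_edge: "hub_coloring {x, y} = (if x = 0 \<or> y = 0 then max x y else 0)"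
  by (auto simp: hub_coloring_def)

lemma infinite_hub_coloring: "infinite (hub_coloring ` nsets UNIV 2)"
proof (rule infinite_coloringI)
  show "\<exists>x y. x \<noteq> y \<and> m \<le> hub_coloring {x, y}" for m
    by (intro exI[of _ 0] exI[of _ "Suc m"]) (simp add: hub_coloring_edge)
qed

text \<open>The edges of nonzero color form the path 0, 1, 2 and the disjoint edges
  \<open>{3, 4}\<close>, \<open>{5, 6}\<close> and so on; their larger endpoints are pairwise
  distinct.\<close>

definition matching_coloring :: "nat set \<Rightarrow> nat" where
  "matching_coloring e = (if e = {0, 1} \<or> (\<exists>i. e = {2 * i + 1, 2 * i + 2}) then Max e else 0)"

lemma matching_coloring_edge:
  "matching_coloring {x, y} = (if {x, y} = {0, 1} \<or> (odd x \<and> y = Suc x) \<or> (odd y \<and> x = Suc y)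
     then max x y else 0)"
proof -
  have "(\<exists>i. {x, y} = {2 * i + 1, 2 * i + 2}) \<longleftrightarrow> (odd x \<and> y = Suc x) \<or> (odd y \<and> x = Suc y)"
    by (auto simp: doubleton_eq_iff elim!: oddE)
  then show ?thesis unfolding matching_coloring_def by simp
qed

lemma infinite_matching_coloring: "infinite (matching_coloring ` nsets UNIV 2)"
proof (rule infinite_coloringI)
  show "\<exists>x y. x \<noteq> y \<and> m \<le> matching_coloring {x, y}" for m
    by (intro exI[of _ "2 * m + 1"] exI[of _ "2 * m + 2"]) (auto simp: matching_coloring_def)
qed

text \<open>The matching covers each vertex at most once, so two nonzero edges can meet only where
  \<open>{0, 1}\<close> is attached to \<open>{1, 2}\<close>.\<close>

lemma matching_coloring_two_edges:
  assumes "matching_coloring {x, y} \<noteq> 0" "matching_coloring {x, z} \<noteq> 0" "y \<noteq> z"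
  shows "x = 1" "{y, z} = {0, 2}"
  using assms unfolding matching_coloring_edge by (auto simp: doubleton_eq_iff split: if_splits)

lemma matching_coloring_three_edges:
  assumes "matching_coloring {x, y} \<noteq> 0" "matching_coloring {x, z} \<noteq> 0"
    "matching_coloring {x, w} \<noteq> 0" "distinct [y, z, w]"
  shows False
  using matching_coloring_two_edges(2)[OF assms(1,2)] matching_coloring_two_edges(2)[OF assms(1,3)]
    assms(4) by (auto simp: doubleton_eq_iff)

text \<open>The blocks are \<open>{4 * k..<4 * k + 4}\<close>. An edge inside a block has a positive
  maximum, so color 0 marks exactly the edges between blocks.\<close>

definition block_coloring :: "nat set \<Rightarrow> nat" where
  "block_coloring e = (if \<exists>k. \<forall>x\<in>e. x div 4 = k then Max e else 0)"

lemma block_coloring_edge: "block_coloring {x, y} = (if x div 4 = y div 4 then max x y else 0)"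
  by (auto simp: block_coloring_def)

lemma infinite_block_coloring: "infinite (block_coloring ` nsets UNIV 2)"
proof (rule infinite_coloringI)
  fix m :: nat
  have "(4 * m + 1) div 4 = m" by presburger
  then show "\<exists>x y. x \<noteq> y \<and> m \<le> block_coloring {x, y}"
    by (intro exI[of _ "4 * m"] exI[of _ "4 * m + 1"]) (simp add: block_coloring_edge)
qed

section \<open>Configurations excluded by each coloring\<close>

text \<open>On a cycle the vertex with the least image gives its color to both of its edges.\<close>

lemma Min_coloring_no_C3:
  assumes H: "simple_graph H" and f: "rainbow_copy Min f H"
  shows "\<not> has_C3 H"
proof
  assume "has_C3 H"
  from has_C3_rainbow_copy[OF H this f] obtain a b c
    where "distinct [f a, f b, f c]"
      "distinct [Min {f a, f b}, Min {f b, f c}, Min {f c, f a}]" .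
  then show False
    by (auto simp: min_def split: if_splits)
qed

lemma Min_coloring_no_C4:
  assumes H: "simple_graph H" and f: "rainbow_copy Min f H"
  shows "\<not> has_C4 H"
proof
  assume "has_C4 H"
  from has_C4_rainbow_copy[OF H this f] obtain a b c d
    where "distinct [f a, f b, f c, f d]"
      "distinct [Min {f a, f b}, Min {f b, f c}, Min {f c, f d}, Min {f d, f a}]" .
  \<comment> \<open>Some vertex of the 4-cycle has an image no larger than those of its two
    neighbours.\<close>
  moreover have "f a \<le> f b \<and> f a \<le> f d \<or> f b \<le> f a \<and> f b \<le> f c \<or>
      f c \<le> f b \<and> f c \<le> f d \<or> f d \<le> f c \<and> f d \<le> f a"
    by linarith
  ultimately show False
    by (elim disjE) (simp_all add: min_absorb1 min_absorb2)
qed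

text \<open>At most one edge of a rainbow copy avoids the vertex sent to 0, since all such edges
  have color 0. Every vertex of the path misses two edges. The same count excludes the 4-cycle and
  the double star.\<close>

lemma hub_coloring_no_P5:
  assumes H: "simple_graph H" and f: "rainbow_copy hub_coloring f H"
  shows "\<not> has_P5 H"
proof
  assume "has_P5 H"
  from has_P5_rainbow_copy[OF H this f] obtain a b c d e
    where "distinct [f a, f b, f c, f d, f e]"
      "distinct [hub_coloring {f a, f b}, hub_coloring {f b, f c}, hub_coloring {f c, f d},
        hub_coloring {f d, f e}]" .
  then show False
    using [[linarith_neq_limit = 0]]
    by (cases "f b = 0"; cases "f c = 0"; cases "f d = 0"; simp add: hub_coloring_edge)
qed

lemma hub_coloring_no_C4:
  assumes H: "simple_graph H" and f: "rainbow_copy hub_coloring f H"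
  shows "\<not> has_C4 H"
proof
  assume "has_C4 H"
  from has_C4_rainbow_copy[OF H this f] obtain a b c d
    where "distinct [f a, f b, f c, f d]"
      "distinct [hub_coloring {f a, f b}, hub_coloring {f b, f c}, hub_coloring {f c, f d},
        hub_coloring {f d, f a}]" .
  then show False
    using [[linarith_neq_limit = 0]]
    by (cases "f a = 0"; cases "f b = 0"; cases "f c = 0"; cases "f d = 0"; simp add: hub_coloring_edge)
qed

lemma hub_coloring_no_double_star:
  assumes H: "simple_graph H" and f: "rainbow_copy hub_coloring f H"
  shows "\<not> has_double_star H"
proof
  assume "has_double_star H"
  from has_double_star_rainbow_copy[OF H this f] obtain u v a b c d
    where "distinct [f u, f v, f a, f b, f c, f d]"
      "distinct [hub_coloring {f u, f v}, hub_coloring {f u, f a}, hub_coloring {f u, f b},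
        hub_coloring {f v, f c}, hub_coloring {f v, f d}]" .
  then show False
    using [[linarith_neq_limit = 0]]
    by (cases "f u = 0"; cases "f v = 0"; cases "f a = 0"; cases "f b = 0"; simp add: hub_coloring_edge)
qed

text \<open>At most one of the four edges has color 0, so three edges of nonzero color would meet at
  the centre.\<close>

lemma matching_coloring_no_K14:
  assumes H: "simple_graph H" and f: "rainbow_copy matching_coloring f H"
  shows "\<not> has_K14 H"
proof
  assume "has_K14 H"
  from has_K14_rainbow_copy[OF H this f] obtain v a b c d
    where d: "distinct [f v, f a, f b, f c, f d]"
      and col: "distinct [matching_coloring {f v, f a}, matching_coloring {f v, f b},
        matching_coloring {f v, f c}, matching_coloring {f v, f d}]" .
  note three = matching_coloring_three_edges[of "f v"]
  consider "matching_coloring {f v, f a} = 0" | "matching_coloring {f v, f b} = 0"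
    | "matching_coloring {f v, f c} = 0" | "matching_coloring {f v, f a} \<noteq> 0"
      "matching_coloring {f v, f b} \<noteq> 0" "matching_coloring {f v, f c} \<noteq> 0"
    by blast
  then show False
    by cases (use three[of "f b" "f c" "f d"] three[of "f a" "f c" "f d"]
      three[of "f a" "f b" "f d"] three[of "f a" "f b" "f c"] d col in auto)
qed

text \<open>Each centre has three edges, at most one of color 0, so two nonzero ones meet there.
  Both centres would be sent to 1.\<close>

lemma matching_coloring_no_double_star:
  assumes H: "simple_graph H" and f: "rainbow_copy matching_coloring f H"
  shows "\<not> has_double_star H"
proof
  assume "has_double_star H"
  from has_double_star_rainbow_copy[OF H this f] obtain u v a b c d
    where d: "distinct [f u, f v, f a, f b, f c, f d]"
      and col: "distinct [matching_coloring {f u, f v}, matching_coloring {f u, f a},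
        matching_coloring {f u, f b}, matching_coloring {f v, f c}, matching_coloring {f v, f d}]" .
  note two = matching_coloring_two_edges(1)
  have vu: "matching_coloring {f v, f u} = matching_coloring {f u, f v}"
    by (simp add: insert_commute)
  have "f u = 1"
    using two[of "f u" "f v" "f a"] two[of "f u" "f v" "f b"] two[of "f u" "f a" "f b"] d col
    by (metis distinct_length_2_or_more)
  moreover have "f v = 1"
    using two[of "f v" "f u" "f c"] two[of "f v" "f u" "f d"] two[of "f v" "f c" "f d"] d col vu
    by (metis distinct_length_2_or_more)
  ultimately show False using d by simp
qed

section \<open>Determining \<open>H\<close> from rainbow copies in the colorings\<close>

text \<open>A triangle with one more edge attached has no rainbow copy here, so connectedness makes
  the triangle all of \<open>H\<close>.\<close>

lemma matching_coloring_C3: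
  assumes H: "simple_graph H" "connected_graph H"
    and f: "rainbow_copy matching_coloring f H" and "has_C3 H"
  shows "graph_iso H (cycle_graph 3)"
proof -
  define M where "M x y \<longleftrightarrow> matching_coloring {f x, f y} \<noteq> 0" for x y
  have M_sym: "M y x" if "M x y" for x y using that by (simp add: M_def insert_commute)
  have inj: "inj_on f (vertices H)" using f by (simp add: rainbow_copy_def)
  have M1: "f x = 1" if "M x y" "M x z" "f y \<noteq> f z" for x y z
    using matching_coloring_two_edges(1) that unfolding M_def by blast
  have M2: False if "M x y" "M x z" "M x w" "distinct [f y, f z, f w]" for x y z w
    using matching_coloring_three_edges that unfolding M_def by blast
  obtain a b c where d: "distinct [a, b, c]" and E: "{{a, b}, {b, c}, {c, a}} \<subseteq> edges H"
    using assms(4) unfolding has_C3_def by (elim exE conjE) (rule that)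
  have V: "{a, b, c} \<subseteq> vertices H" using Union_subset_vertices[OF H(1) E] by simp
  have fd: "distinct [f a, f b, f c]" using rainbow_copy_distinct[OF f d] V by simp
  \<comment> \<open>A rainbow copy has at most one edge of color 0.\<close>
  have edge: "{x, y} \<in> edges H \<Longrightarrow> {z, w} \<in> edges H \<Longrightarrow> {x, y} \<noteq> {z, w} \<Longrightarrow> M x y \<or> M z w"
    for x y z w
    using rainbow_copy_colors[OF f, of "[{x, y}, {z, w}]"] unfolding M_def by auto
  have extra: "q = y \<or> q = z"
    if d: "distinct [f x, f y, f z]" and V: "y \<in> vertices H" "z \<in> vertices H"
      and E: "{x, y} \<in> edges H" "{y, z} \<in> edges H" "{x, z} \<in> edges H" "{x, q} \<in> edges H"
    for x y z q
  proof (rule ccontr)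
    assume q: "\<not> (q = y \<or> q = z)"
    have qV: "q \<in> vertices H" using edgeD[OF H(1) E(4)] by blast
    have fq: "f q \<noteq> f y" "f q \<noteq> f z" using q qV V inj by (auto dest: inj_onD)
    have "{x, q} \<noteq> {x, y}" "{x, q} \<noteq> {x, z}" "{x, q} \<noteq> {y, z}" "{x, y} \<noteq> {y, z}"
      "{x, z} \<noteq> {y, z}" "{x, y} \<noteq> {x, z}"
      using q d by (auto simp: doubleton_eq_iff)
    then have M: "M x q \<or> M x y" "M x q \<or> M x z" "M x q \<or> M y z" "M x y \<or> M y z" "M x z \<or> M y z"
      "M x y \<or> M x z"
      using edge[OF E(4) E(1)] edge[OF E(4) E(3)] edge[OF E(4) E(2)] edge[OF E(1) E(2)]
        edge[OF E(3) E(2)] edge[OF E(1) E(3)] by simp_all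
    show False
    \<comment> \<open>If \<open>{y, z}\<close> has nonzero color, then \<open>x\<close> and one of
      \<open>y\<close>, \<open>z\<close> each meet two nonzero edges and would both be sent to 1.
      Otherwise all three edges at \<open>x\<close> are nonzero.\<close>
    proof (cases "M y z")
      case True
      then have "M z y" by (rule M_sym)
      have "M x q \<or> (M x y \<and> M x z)" using M by blast
      then have "f x = 1" using M M1[of x q y] M1[of x q z] M1[of x y z] fq d by auto
      moreover have "f y = 1 \<or> f z = 1"
        using M True \<open>M z y\<close> M_sym M1[of y x z] M1[of z x y] d by auto
      ultimately show False using d by auto
    next
      case False
      then show False using M M2[of x q y z] fq d by auto
    qed
  qed
  have "vertices H = {a, b, c} \<and> edges H = {{a, b}, {b, c}, {c, a}}"
  proof (rule connected_eq[OF H, of a])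
    fix u q assume uq: "u \<in> {a, b, c}" "{u, q} \<in> edges H"
    consider "u = a" | "u = b" | "u = c" using uq by blast
    then show "{u, q} \<in> {{a, b}, {b, c}, {c, a}}"
    proof cases
      case 1
      then show ?thesis using extra[of a b c q] fd V E uq by (auto simp: insert_commute)
    next
      case 2
      then show ?thesis using extra[of b a c q] fd V E uq by (auto simp: insert_commute)
    next
      case 3
      then show ?thesis using extra[of c a b q] fd V E uq by (auto simp: insert_commute)
    qed
  qed (use V E in auto)
  then show ?thesis using graph_iso_cycle_graph_3[OF d, of H] by simp
qed

text \<open>The path already uses up the one edge of color 0, so any further edge at it would be
  nonzero; the nonzero edges leave no room for it.\<close>

lemma matching_coloring_P5:
  assumes H: "simple_graph H" "connected_graph H"
    and f: "rainbow_copy matching_coloring f H" and "has_P5 H"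
  shows "graph_iso H (path_graph 5)"
proof -
  define M where "M x y \<longleftrightarrow> matching_coloring {f x, f y} \<noteq> 0" for x y
  have M_sym: "M y x" if "M x y" for x y using that by (simp add: M_def insert_commute)
  have inj: "inj_on f (vertices H)" using f by (simp add: rainbow_copy_def)
  have M1: "f x = 1" if "M x y" "M x z" "f y \<noteq> f z" for x y z
    using matching_coloring_two_edges(1) that unfolding M_def by blast
  have M2: False if "M x y" "M x z" "M x w" "distinct [f y, f z, f w]" for x y z w
    using matching_coloring_three_edges that unfolding M_def by blast
  obtain a b c d e where dist: "distinct [a, b, c, d, e]"
    and E: "{{a, b}, {b, c}, {c, d}, {d, e}} \<subseteq> edges H"
    using assms(4) unfolding has_P5_def by (elim exE conjE) (rule that)
  have V: "{a, b, c, d, e} \<subseteq> vertices H" using Union_subset_vertices[OF H(1) E] by simp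
  have fd: "distinct [f a, f b, f c, f d, f e]" using rainbow_copy_distinct[OF f dist] V by simp
  have edge: "{x, y} \<in> edges H \<Longrightarrow> {z, w} \<in> edges H \<Longrightarrow> {x, y} \<noteq> {z, w} \<Longrightarrow> M x y \<or> M z w"
    for x y z w
    using rainbow_copy_colors[OF f, of "[{x, y}, {z, w}]"] unfolding M_def by auto
  have E': "{a, b} \<in> edges H" "{b, c} \<in> edges H" "{c, d} \<in> edges H" "{d, e} \<in> edges H"
    using E by simp_all
  \<comment> \<open>Three consecutive nonzero edges would send two vertices to 1. Hence color 0 does
    occur on the path, and on one of the two middle edges.\<close>
  have inner: "M a b \<and> M d e \<and> (M b c \<longleftrightarrow> \<not> M c d)"
  proof -
    have "{a, b} \<noteq> {b, c}" "{a, b} \<noteq> {c, d}" "{a, b} \<noteq> {d, e}" "{b, c} \<noteq> {c, d}"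
      "{b, c} \<noteq> {d, e}" "{c, d} \<noteq> {d, e}"
      using dist by (auto simp: doubleton_eq_iff)
    then have M: "M a b \<or> M b c" "M a b \<or> M c d" "M a b \<or> M d e" "M b c \<or> M c d"
      "M b c \<or> M d e" "M c d \<or> M d e"
      using edge[OF E'(1) E'(2)] edge[OF E'(1) E'(3)] edge[OF E'(1) E'(4)] edge[OF E'(2) E'(3)]
        edge[OF E'(2) E'(4)] edge[OF E'(3) E'(4)] by simp_all
    have "\<not> (M b c \<and> M c d \<and> M d e)"
      using M1[of c b d] M1[of d c e] M_sym fd by auto
    moreover have "\<not> (M a b \<and> M b c \<and> M c d)"
      using M1[of b a c] M1[of c b d] M_sym fd by auto
    ultimately show ?thesis using M by blast
  qed
  have extra: "{p, q} \<in> {{a, b}, {b, c}, {c, d}, {d, e}}"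
    if p: "p \<in> {a, b, c, d, e}" and pq: "{p, q} \<in> edges H" for p q
  proof (rule ccontr)
    assume new: "{p, q} \<notin> {{a, b}, {b, c}, {c, d}, {d, e}}"
    then have "{p, q} \<noteq> {b, c}" "{p, q} \<noteq> {c, d}" by auto
    then have Mpq: "M p q" using inner edge[OF pq E'(2)] edge[OF pq E'(3)]
      by (cases "M c d") simp_all
    have qV: "q \<in> vertices H" using edgeD[OF H(1) pq] by blast
    have fq: "f x \<noteq> f q" if "x \<in> {a, b, c, d, e}" "q \<noteq> x" for x
      using that qV V inj by (auto dest: inj_onD)
    have nq: "p = a \<Longrightarrow> q \<noteq> b" "p = b \<Longrightarrow> q \<noteq> a" "p = b \<Longrightarrow> q \<noteq> c" "p = c \<Longrightarrow> q \<noteq> b"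
      "p = c \<Longrightarrow> q \<noteq> d" "p = d \<Longrightarrow> q \<noteq> c" "p = d \<Longrightarrow> q \<noteq> e" "p = e \<Longrightarrow> q \<noteq> d"
      using new by (auto simp: insert_commute)
    have M': "M b a" "M e d" using inner M_sym by blast+
    \<comment> \<open>The vertex sent to 1 is \<open>b\<close> or \<open>d\<close>. A new edge there
      would be a third nonzero one; any other vertex of the path already has a nonzero edge, so a
      second would send it to 1 too.\<close>
    consider "M b c" "f b = 1" | "M c d" "f d = 1"
      using inner M1[of b a c] M1[of d c e] M_sym fd by auto
    then show False
    proof cases
      case 1
      have "M c b" using 1(1) by (rule M_sym)
      have "p = b \<Longrightarrow> False"
        using M2[of b a c q] Mpq inner M' 1 fd fq[of a] fq[of c] nq by auto
      moreover have "p = a \<Longrightarrow> False"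
        using M1[of a b q] Mpq inner 1 fd fq[of b] nq by auto
      moreover have "p = c \<Longrightarrow> False"
        using M1[of c b q] Mpq \<open>M c b\<close> 1 fd fq[of b] nq by auto
      moreover have "p = d \<Longrightarrow> False"
        using M1[of d e q] Mpq inner 1 fd fq[of e] nq by auto
      moreover have "p = e \<Longrightarrow> False"
        using M1[of e d q] Mpq inner M' 1 fd fq[of d] nq by auto
      ultimately show False using p by blast
    next
      case 2
      have "M d c" using 2(1) by (rule M_sym)
      have "p = d \<Longrightarrow> False"
        using M2[of d e c q] Mpq inner \<open>M d c\<close> fd fq[of e] fq[of c] nq by auto
      moreover have "p = a \<Longrightarrow> False"
        using M1[of a b q] Mpq inner 2 fd fq[of b] nq by auto
      moreover have "p = c \<Longrightarrow> False"
        using M1[of c d q] Mpq 2 fd fq[of d] nq by auto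
      moreover have "p = b \<Longrightarrow> False"
        using M1[of b a q] Mpq inner M' 2 fd fq[of a] nq by auto
      moreover have "p = e \<Longrightarrow> False"
        using M1[of e d q] Mpq inner M' 2 fd fq[of d] nq by auto
      ultimately show False using p by blast
    qed
  qed
  have "vertices H = {a, b, c, d, e} \<and> edges H = {{a, b}, {b, c}, {c, d}, {d, e}}"
    by (rule connected_eq[OF H, of a]) (use V E extra in auto)
  then show ?thesis using graph_iso_path_graph(5)[OF dist, of H] by simp
qed

text \<open>Of five edges at \<open>v\<close> at most one leaves the block of \<open>f v\<close>.
  The other four ends and \<open>v\<close> itself would be five vertices in a block of four.\<close>

lemma block_coloring_degree:
  assumes H: "simple_graph H" and f: "rainbow_copy block_coloring f H"
    and d: "distinct [a, b, c, d, e]"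
    and E: "{{v, a}, {v, b}, {v, c}, {v, d}, {v, e}} \<subseteq> edges H"
  shows False
proof -
  define N where "N = {a, b, c, d, e}"
  define B where "B = {n. n div 4 = f v div 4}"
  have V: "insert v N \<subseteq> vertices H" using Union_subset_vertices[OF H E] by (simp add: N_def)
  have inj: "inj_on f (insert v N)"
    using f inj_on_subset[OF _ V, of f] unfolding rainbow_copy_def by blast
  have v: "v \<notin> N" using E edgeD(3)[OF H] by (auto simp: N_def)
  have one: "f x \<in> B \<or> f y \<in> B" if "x \<in> N" "y \<in> N" "x \<noteq> y" for x y
  proof -
    have "{v, x} \<in> edges H" "{v, y} \<in> edges H" using that E by (auto simp: N_def)
    moreover have "{v, x} \<noteq> {v, y}" using that by (auto simp: doubleton_eq_iff)
    ultimately have "block_coloring {f v, f x} \<noteq> block_coloring {f v, f y}"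
      using rainbow_copy_colors[OF f, of "[{v, x}, {v, y}]"] by auto
    then show ?thesis by (auto simp: block_coloring_edge B_def split: if_splits)
  qed
  \<comment> \<open>\<open>x\<close> is the one neighbour possibly outside the block; if there is
    none, \<open>a\<close> is taken.\<close>
  obtain x where x: "x \<in> N" "f ` (N - {x}) \<subseteq> B"
  proof (cases "f ` N \<subseteq> B")
    case True
    then show thesis using that[of a] by (auto simp: N_def)
  next
    case False
    then obtain x where "x \<in> N" "f x \<notin> B" by blast
    then show thesis using that one by blast
  qed
  have "f ` insert v (N - {x}) \<subseteq> B" using x by (auto simp: B_def)
  moreover have "B \<subseteq> {4 * (f v div 4)..<4 * (f v div 4) + 4}" by (auto simp: B_def)
  ultimately have "f ` insert v (N - {x}) \<subseteq> {4 * (f v div 4)..<4 * (f v div 4) + 4}"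
    by (rule subset_trans)
  from card_mono[OF _ this] have "card (f ` insert v (N - {x})) \<le> 4" by simp
  moreover have "card (f ` insert v (N - {x})) = card (insert v (N - {x}))"
    by (rule card_image[OF inj_on_subset[OF inj]]) blast
  moreover have "finite N" "card N = 5" using d by (auto simp: N_def)
  ultimately show False using x(1) v by simp
qed

text \<open>The star must be centred at the hub, so at most one edge of \<open>H\<close> avoids
  \<open>v\<close>. The degree bound fixes the neighbours of \<open>v\<close>, and without triangles
  the extra edge can only join a leaf to a new vertex.\<close>

lemma hub_coloring_K14:
  assumes H: "simple_graph H" "connected_graph H"
    and f: "rainbow_copy hub_coloring f H" and "has_K14 H" and C3: "\<not> has_C3 H"
    and deg: "\<And>v a b c d e. distinct [a, b, c, d, e] \<Longrightarrow>
      {{v, a}, {v, b}, {v, c}, {v, d}, {v, e}} \<subseteq> edges H \<Longrightarrow> False"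
  shows "graph_iso H (star_graph 4) \<or> graph_iso H (star_plus_graph 4)"
proof -
  obtain v a b c d where dist: "distinct [v, a, b, c, d]"
    and E: "{{v, a}, {v, b}, {v, c}, {v, d}} \<subseteq> edges H"
    and V: "{v, a, b, c, d} \<subseteq> vertices H" and "distinct [f v, f a, f b, f c, f d]"
    and "distinct [hub_coloring {f v, f a}, hub_coloring {f v, f b},
      hub_coloring {f v, f c}, hub_coloring {f v, f d}]"
    by (rule has_K14_rainbow_copy[OF H(1) assms(4) f])
  \<comment> \<open>If \<open>f v\<close> were nonzero, at least three edges of the star would have
    color 0.\<close>
  then have fv: "f v = 0" by (auto simp: hub_coloring_edge split: if_splits)
  have N: "x \<in> {a, b, c, d}" if "{v, x} \<in> edges H" for x
    using deg[of a b c d x v] dist E that by auto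
  have Ev: "{v, u} \<in> edges H" if "u \<in> {a, b, c, d}" for u using that E by auto
  have unique: "{x, y} = {z, w}"
    if "{x, y} \<in> edges H" "{z, w} \<in> edges H" "v \<notin> {x, y}" "v \<notin> {z, w}" for x y z w
  proof (rule ccontr)
    assume "{x, y} \<noteq> {z, w}"
    with that have "hub_coloring {f x, f y} \<noteq> hub_coloring {f z, f w}"
      using rainbow_copy_colors[OF f, of "[{x, y}, {z, w}]"] by auto
    moreover have "f u \<noteq> 0" if "u \<in> vertices H" "u \<noteq> v" for u
      using f fv that V unfolding rainbow_copy_def by (metis inj_onD insert_subset)
    then have "f x \<noteq> 0" "f y \<noteq> 0" "f z \<noteq> 0" "f w \<noteq> 0"
      using that edgeD[OF H(1)] by blast+
    ultimately show False by (simp add: hub_coloring_edge)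
  qed
  \<comment> \<open>\<open>x\<close>, \<open>y\<close>, \<open>z\<close>, \<open>p\<close> rearrange
    the leaves so that \<open>p\<close> carries the extra edge.\<close>
  have star_plus: "graph_iso H (star_plus_graph 4)"
    if S: "{a, b, c, d} = {x, y, z, p}" and dist': "distinct [v, x, y, z, p]"
      and pw: "{p, w} \<in> edges H" "w \<noteq> v" for x y z p w
  proof -
    have w: "w \<notin> {x, y, z, p}"
    proof
      assume "w \<in> {x, y, z, p}"
      then have "w \<in> {a, b, c, d}" "p \<in> {a, b, c, d}" unfolding S by simp_all
      then have "{v, w} \<in> edges H" "{v, p} \<in> edges H" by (simp_all only: Ev)
      moreover have "distinct [v, p, w]" using edgeD(3)[OF H(1) pw(1)] pw(2) dist' by auto
      ultimately have "has_C3 H" using pw(1) unfolding has_C3_def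
        by (intro exI[of _ v] exI[of _ p] exI[of _ w]) (simp add: insert_commute)
      with C3 show False by blast
    qed
    have E': "{v, x} \<in> edges H" "{v, y} \<in> edges H" "{v, z} \<in> edges H" "{v, p} \<in> edges H"
      by (rule Ev, unfold S, simp)+
    have V': "x \<in> vertices H" "y \<in> vertices H" "z \<in> vertices H" "p \<in> vertices H" "w \<in> vertices H"
      using edgeD(2)[OF H(1)] E' pw by blast+
    have "vertices H = {v, x, y, z, p, w} \<and> edges H = {{v, x}, {v, y}, {v, z}, {v, p}, {p, w}}"
    proof (rule connected_eq[OF H, of v])
      fix u q assume uq: "u \<in> {v, x, y, z, p, w}" "{u, q} \<in> edges H"
      consider "u = v" | "q = v" | "u \<noteq> v" "q \<noteq> v" by blast
      then show "{u, q} \<in> {{v, x}, {v, y}, {v, z}, {v, p}, {p, w}}"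
      proof cases
        case 1
        then show ?thesis using N[of q] uq S by auto
      next
        case 2
        then have "u \<in> {x, y, z, p}" using N[of u] uq S by (simp add: insert_commute)
        then show ?thesis using 2 by (auto simp: insert_commute)
      next
        case 3
        then have "{u, q} = {p, w}" using unique uq(2) pw dist' by auto
        then show ?thesis by simp
      qed
    qed (use V V' E' pw in auto)
    moreover have "distinct [v, x, y, z, p, w]" using w dist' pw by auto
    ultimately show ?thesis using graph_iso_star_plus_graph(2)[of v x y z p w H] by blast
  qed
  show ?thesis
  proof (cases "\<exists>p\<in>{a, b, c, d}. \<exists>w. {p, w} \<in> edges H \<and> w \<noteq> v")
    case True
    then obtain p w where p: "p \<in> {a, b, c, d}" "{p, w} \<in> edges H" "w \<noteq> v" by blast
    then consider "p = a" | "p = b" | "p = c" | "p = d" by blast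
    then have "graph_iso H (star_plus_graph 4)"
    proof cases
      case 1
      then show ?thesis using star_plus[of b c d a w] dist p by auto
    next
      case 2
      then show ?thesis using star_plus[of a c d b w] dist p by auto
    next
      case 3
      then show ?thesis using star_plus[of a b d c w] dist p by auto
    next
      case 4
      then show ?thesis using star_plus[of a b c d w] dist p by auto
    qed
    then show ?thesis ..
  next
    case False
    have "vertices H = {v, a, b, c, d} \<and> edges H = {{v, a}, {v, b}, {v, c}, {v, d}}"
    proof (rule connected_eq[OF H, of v])
      fix u q assume uq: "u \<in> {v, a, b, c, d}" "{u, q} \<in> edges H"
      show "{u, q} \<in> {{v, a}, {v, b}, {v, c}, {v, d}}"
      proof (cases "u = v")
        case True
        then show ?thesis using N[of q] uq by auto
      next
        case u: False
        then have "q = v" using False uq by blast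
        then show ?thesis using u uq by (auto simp: insert_commute)
      qed
    qed (use V E in auto)
    then show ?thesis using graph_iso_star_graph(2)[OF dist, of H] by simp
  qed
qed

section \<open>Rainbow copies of the three target graphs, and the conclusion\<close>

text \<open>Along 0, 1, 2, 3, 4 the colors are 0, 1, 2, 3 for \<open>Min\<close> and 1, 2, 0, 4 for
  \<open>matching_coloring\<close>.\<close>

lemma path_5_rainbow_copy:
  "\<exists>g. rainbow_copy Min g (path_graph 5)"
  "\<exists>g. rainbow_copy matching_coloring g (path_graph 5)"
  using rainbow_copy_P5[of 0 1 2 3 4 Min UNIV] rainbow_copy_P5[of 0 1 2 3 4 matching_coloring UNIV]
  by (auto simp: matching_coloring_edge doubleton_eq_iff)

lemma cycle_3_rainbow_copy:
  "\<exists>g. rainbow_copy hub_coloring g (cycle_graph 3)"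
  "\<exists>g. rainbow_copy matching_coloring g (cycle_graph 3)"
  using rainbow_copy_C3[of 0 1 2 hub_coloring UNIV] rainbow_copy_C3[of 0 1 2 matching_coloring UNIV]
  by (auto simp: hub_coloring_edge matching_coloring_edge doubleton_eq_iff)

text \<open>For \<open>Min\<close> the centre has to exceed the leaves, hence 4. With centre 0 and
  leaves 1, 2, 3, 4 the block coloring gives 1, 2, 3, 0, the last edge leaving the block.\<close>

lemma star_4_rainbow_copy:
  "\<exists>g. rainbow_copy Min g (star_graph 4)"
  "\<exists>g. rainbow_copy hub_coloring g (star_graph 4)"
  "\<exists>g. rainbow_copy block_coloring g (star_graph 4)"
  using rainbow_copy_K14[of 4 0 1 2 3 Min UNIV] rainbow_copy_K14[of 0 1 2 3 4 hub_coloring UNIV]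
    rainbow_copy_K14[of 0 1 2 3 4 block_coloring UNIV]
  by (auto simp: hub_coloring_edge block_coloring_edge)

theorem theorem19:
  fixes H :: "'a sgraph"
  assumes "in_calH H"
    and "\<not> graph_iso H (star_graph 3)"
    and "\<not> graph_iso H (star_plus_graph 3)"
  shows "(rainbow_le (star_graph 4) H \<or> rainbow_le (path_graph 5) H \<or> rainbow_le (cycle_graph 3) H)
    \<and> (rainbow_le H (path_graph 5) \<longrightarrow> graph_iso H (path_graph 5))
    \<and> (rainbow_le H (cycle_graph 3) \<longrightarrow> graph_iso H (cycle_graph 3))
    \<and> (rainbow_le H (star_graph 4) \<longrightarrow>
         graph_iso H (star_graph 4) \<or> graph_iso H (star_plus_graph 4))"
proof (intro conjI impI)
  have H: "simple_graph H" "connected_graph H"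
    and path: "\<And>k. k \<in> {1, 2, 3, 4} \<Longrightarrow> \<not> graph_iso H (path_graph k)"
    using assms(1) by (auto simp: in_calH_def)
  note cases = forbidden_subgraph_cases[OF H path assms(2,3)]
  show "rainbow_le (star_graph 4) H \<or> rainbow_le (path_graph 5) H \<or> rainbow_le (cycle_graph 3) H"
    using cases has_K14_imp_rainbow_le[OF H(1)] has_P5_imp_rainbow_le[OF H(1)]
      has_C3_imp_rainbow_le[OF H(1)] has_C4_imp_rainbow_le[OF H(1)]
      has_double_star_imp_rainbow_le[OF H(1)] by blast
  show "graph_iso H (path_graph 5)" if le: "rainbow_le H (path_graph 5)"
  proof -
    obtain f where f: "rainbow_copy Min f H"
      using rainbow_le_infinite[OF le H(1) simple_path_graph infinite_Min_coloring]
        path_5_rainbow_copy(1) by blast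
    obtain f' where f': "rainbow_copy matching_coloring f' H"
      using rainbow_le_infinite[OF le H(1) simple_path_graph infinite_matching_coloring]
        path_5_rainbow_copy(2) by blast
    \<comment> \<open>\<open>Min\<close> rules out both cycles, the matching coloring the star and
      the double star.\<close>
    have "has_P5 H"
      using cases Min_coloring_no_C3[OF H(1) f] Min_coloring_no_C4[OF H(1) f]
        matching_coloring_no_K14[OF H(1) f'] matching_coloring_no_double_star[OF H(1) f'] by blast
    then show ?thesis by (rule matching_coloring_P5[OF H f'])
  qed
  show "graph_iso H (cycle_graph 3)" if le: "rainbow_le H (cycle_graph 3)"
  proof -
    obtain f where f: "rainbow_copy hub_coloring f H"
      using rainbow_le_infinite[OF le H(1) simple_cycle_graph_3 infinite_hub_coloring]
        cycle_3_rainbow_copy(1) by blast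
    obtain f' where f': "rainbow_copy matching_coloring f' H"
      using rainbow_le_infinite[OF le H(1) simple_cycle_graph_3 infinite_matching_coloring]
        cycle_3_rainbow_copy(2) by blast
    \<comment> \<open>The hub coloring leaves only the triangle and the star; the matching coloring
      removes the star.\<close>
    have "has_C3 H"
      using cases hub_coloring_no_P5[OF H(1) f] hub_coloring_no_C4[OF H(1) f]
        hub_coloring_no_double_star[OF H(1) f] matching_coloring_no_K14[OF H(1) f'] by blast
    then show ?thesis by (rule matching_coloring_C3[OF H f'])
  qed
  show "graph_iso H (star_graph 4) \<or> graph_iso H (star_plus_graph 4)"
    if le: "rainbow_le H (star_graph 4)"
  proof -
    obtain f where f: "rainbow_copy hub_coloring f H"
      using rainbow_le_infinite[OF le H(1) simple_star_graph infinite_hub_coloring]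
        star_4_rainbow_copy(2) by blast
    obtain f' where f': "rainbow_copy Min f' H"
      using rainbow_le_infinite[OF le H(1) simple_star_graph infinite_Min_coloring]
        star_4_rainbow_copy(1) by blast
    obtain f'' where f'': "rainbow_copy block_coloring f'' H"
      using rainbow_le_infinite[OF le H(1) simple_star_graph infinite_block_coloring]
        star_4_rainbow_copy(3) by blast
    have C3: "\<not> has_C3 H" by (rule Min_coloring_no_C3[OF H(1) f'])
    \<comment> \<open>Here \<open>Min\<close> removes the triangle instead, and the block coloring
      then supplies the degree bound.\<close>
    have "has_K14 H"
      using cases hub_coloring_no_P5[OF H(1) f] hub_coloring_no_C4[OF H(1) f]
        hub_coloring_no_double_star[OF H(1) f] C3 by blast
    then show ?thesis
      by (rule hub_coloring_K14[OF H f _ C3 block_coloring_degree[OF H(1) f'']])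
  qed
qed

end
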